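(* Assume $\mathsf{MA}(\omega_1)$ and $2^{\omega_1}=\omega_2$. Then there is a Fréchet topology on the set $X=\omega_2+1$ such that $t(X_\delta)=\omega_2$.
   Context: $\mathsf{MA}(\omega_1)$ is Martin's axiom for $\omega_1$ many dense sets: for every ccc partial order $P$ and every family of at most $\omega_1$ dense subsets of $P$ there is a filter on $P$ meeting all of them. For a topological space $X$, the $G_\delta$-modification $X_\delta$ is the space with the same underlying set as $X$ and with the $G_\delta$ subsets of $X$ as a base for its topology. Tightness: for a point $x$ of a space $X$, $t(x,X)$ is the minimum cardinal $\kappa$ such that for every $A\subseteq X$ with $x\in\overline{A}$ there is $B\subseteq A$ with $|B|\le\kappa$ and $x\in\overline{B}$. The tightness of $X$ is $t(X)=\sup_{x\in X}t(x,X)$. A topology on $X$ is Fréchet if for every $x\in X$ and every $A\subseteq X$, $x\in\overline{A}$ if and only if there is a sequence $\{x_n:n<\omega\}\subseteq A$ converging to $x$. *)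

theory Defs
  imports "HOL-Analysis.Analysis"
begin

unbundle cardinal_syntax
no_notation elt_set_eq (infix \<open>=o\<close> 50)

section \<open>The cardinals \<open>\<omega>\<^sub>1\<close> and \<open>\<omega>\<^sub>2\<close>\<close>

abbreviation omega1 :: "nat set rel" where
  "omega1 \<equiv> cardSuc natLeq"

abbreviation omega2 :: "nat set set rel" where
  "omega2 \<equiv> cardSuc omega1"

text \<open>The ordinal \<open>\<omega>\<^sub>2 + 1\<close>: \<open>Some \<alpha>\<close> represents an ordinal \<open>\<alpha> < \<omega>\<^sub>2\<close> and \<open>None\<close> represents
  the top element \<open>\<omega>\<^sub>2\<close>.\<close>

definition omega2_plus_1 :: "nat set set option set" where
  "omega2_plus_1 = insert None (Some ` Field omega2)"

lemma Card_order_omega1: "Card_order omega1"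
  by (simp add: cardSuc_Card_order natLeq_Card_order)

lemma Card_order_omega2: "Card_order omega2"
  by (simp add: cardSuc_Card_order Card_order_omega1)

lemma infinite_Field_omega1: "\<not> finite (Field omega1)"
  using cardSuc_finite[OF natLeq_Card_order] by (simp add: Field_natLeq)


section \<open>Martin's axiom for \<open>\<omega>\<^sub>1\<close> dense sets\<close>

text \<open>A partial order is given by a carrier \<open>A\<close> and a relation \<open>r\<close>, where \<open>(p, q) \<in> r\<close> means
  that \<open>p \<le> q\<close>, i.e. that \<open>p\<close> is stronger than \<open>q\<close>.\<close>

definition compatible_in :: "'a set \<Rightarrow> 'a rel \<Rightarrow> 'a \<Rightarrow> 'a \<Rightarrow> bool" where
  "compatible_in A r p q \<longleftrightarrow> (\<exists>s\<in>A. (s, p) \<in> r \<and> (s, q) \<in> r)"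

definition antichain_in :: "'a set \<Rightarrow> 'a rel \<Rightarrow> 'a set \<Rightarrow> bool" where
  "antichain_in A r C \<longleftrightarrow> C \<subseteq> A \<and> (\<forall>p\<in>C. \<forall>q\<in>C. p \<noteq> q \<longrightarrow> \<not> compatible_in A r p q)"

definition ccc :: "'a set \<Rightarrow> 'a rel \<Rightarrow> bool" where
  "ccc A r \<longleftrightarrow> (\<forall>C. antichain_in A r C \<longrightarrow> countable C)"

definition dense_in_order :: "'a set \<Rightarrow> 'a rel \<Rightarrow> 'a set \<Rightarrow> bool" where
  "dense_in_order A r D \<longleftrightarrow> D \<subseteq> A \<and> (\<forall>p\<in>A. \<exists>d\<in>D. (d, p) \<in> r)"

definition filter_in_order :: "'a set \<Rightarrow> 'a rel \<Rightarrow> 'a set \<Rightarrow> bool" where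
  "filter_in_order A r G \<longleftrightarrow> G \<subseteq> A \<and> G \<noteq> {} \<and>
     (\<forall>p\<in>G. \<forall>q\<in>A. (p, q) \<in> r \<longrightarrow> q \<in> G) \<and>
     (\<forall>p\<in>G. \<forall>q\<in>G. \<exists>s\<in>G. (s, p) \<in> r \<and> (s, q) \<in> r)"

text \<open>A formula cannot quantify over types, so the axiom is stated for the partial orders whose
  carrier lies in a given type. Lemma \<open>MA_omega1_transfer\<close> below shows that its instance for
  \<open>nat set set\<close> implies its instance for every type. Carriers are nonempty, as usual for
  forcing notions (the empty order has no filter).\<close>

definition MA_omega1 :: "'a itself \<Rightarrow> bool" where
  "MA_omega1 (_ :: 'a itself) \<longleftrightarrow>
     (\<forall>(A :: 'a set) r \<D>.
        A \<noteq> {} \<and> partial_order_on A r \<and> ccc A r \<and>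
        |\<D>| \<le>o omega1 \<and> (\<forall>D\<in>\<D>. dense_in_order A r D) \<longrightarrow>
        (\<exists>G. filter_in_order A r G \<and> (\<forall>D\<in>\<D>. G \<inter> D \<noteq> {})))"

lemma closed_subset_omega1:
  fixes \<D> :: "'d set" and d :: "'d \<Rightarrow> 'a \<Rightarrow> 'a" and c :: "'a \<Rightarrow> 'a \<Rightarrow> 'a"
  assumes D: "|\<D>| \<le>o omega1" and "a0 \<in> A"
    and dA: "\<And>D p. D \<in> \<D> \<Longrightarrow> p \<in> A \<Longrightarrow> d D p \<in> A"
    and cA: "\<And>p q. p \<in> A \<Longrightarrow> q \<in> A \<Longrightarrow> c p q \<in> A"
  obtains Q where "a0 \<in> Q" "Q \<subseteq> A" "|Q| \<le>o omega1"
    "\<And>D p. D \<in> \<D> \<Longrightarrow> p \<in> Q \<Longrightarrow> d D p \<in> Q" "\<And>p q. p \<in> Q \<Longrightarrow> q \<in> Q \<Longrightarrow> c p q \<in> Q"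
proof -
  define step where "step S = S \<union> (case_prod d ` (\<D> \<times> S) \<union> case_prod c ` (S \<times> S))" for S
  define Q where "Q n = (step ^^ n) {a0}" for n
  have Suc: "Q (Suc n) = step (Q n)" for n by (simp add: Q_def)
  have mono: "Q m \<subseteq> Q n" if "m \<le> n" for m n
    by (rule lift_Suc_mono_le[OF _ that]) (auto simp: Suc step_def)
  note inf = infinite_Field_omega1
  note co = Card_order_omega1
  have im: "|g ` S| \<le>o omega1" if "|S| \<le>o omega1" for g :: "'e \<Rightarrow> 'f" and S
    using card_of_image that by (rule ordLeq_transitive)
  have card: "|Q n| \<le>o omega1" for n
  proof (induction n)
    case 0
    have "|{a0}| \<le>o |Field omega1|"
      using inf by (intro card_of_singl_ordLeq) auto
    then show ?case
      unfolding Q_def using card_of_Field_ordIso[OF co] by (auto intro: ordLeq_ordIso_trans)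
  next
    case (Suc n)
    show ?case
      unfolding \<open>Q (Suc n) = step (Q n)\<close> step_def
      by (intro card_of_Un_ordLeq_infinite_Field card_of_Times_ordLeq_infinite_Field im
            Suc D inf co)
  qed
  have sub: "Q n \<subseteq> A" for n
  proof (induction n)
    case 0
    show ?case using \<open>a0 \<in> A\<close> by (simp add: Q_def)
  next
    case (Suc n)
    then have "x \<in> A" if "x \<in> Q n" for x using that by blast
    then show ?case
      unfolding \<open>Q (Suc n) = step (Q n)\<close> step_def by (auto intro: dA cA)
  qed
  show ?thesis
  proof (rule that[of "\<Union>n. Q n"])
    show "a0 \<in> (\<Union>n. Q n)" by (auto intro!: exI[of _ 0] simp: Q_def)
    show "(\<Union>n. Q n) \<subseteq> A" using sub by auto
    have "|UNIV :: nat set| \<le>o omega1"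
      using card_of_nat cardSuc_ordLeq[OF natLeq_Card_order] by (rule ordIso_ordLeq_trans)
    then show "|\<Union>n. Q n| \<le>o omega1"
      using card by (intro card_of_UNION_ordLeq_infinite_Field inf co) auto
    show "d D p \<in> (\<Union>n. Q n)" if D: "D \<in> \<D>" and p: "p \<in> (\<Union>n. Q n)" for D p
    proof -
      from p obtain n where "p \<in> Q n" by auto
      with D have "d D p \<in> Q (Suc n)" unfolding Suc step_def by force
      then show ?thesis by blast
    qed
    show "c p q \<in> (\<Union>n. Q n)" if p: "p \<in> (\<Union>n. Q n)" and q: "q \<in> (\<Union>n. Q n)" for p q
    proof -
      from p q obtain m n where "p \<in> Q m" "q \<in> Q n" by auto
      then have "p \<in> Q (max m n)" "q \<in> Q (max m n)"
        using mono[of m "max m n"] mono[of n "max m n"] by auto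
      then have "c p q \<in> Q (Suc (max m n))" unfolding Suc step_def by force
      then show ?thesis by blast
    qed
  qed
qed

lemma MA_omega1_transfer:
  assumes MA: "MA_omega1 TYPE(nat set set)"
  shows "MA_omega1 TYPE('a)"
  unfolding MA_omega1_def
proof (intro allI impI, elim conjE)
  fix A :: "'a set" and r :: "'a rel" and \<D> :: "'a set set"
  assume "A \<noteq> {}" and po: "partial_order_on A r" and ccc: "ccc A r"
    and card: "|\<D>| \<le>o omega1" and dense: "\<forall>D\<in>\<D>. dense_in_order A r D"
  then obtain a0 where a0: "a0 \<in> A" by blast
  have rA: "p \<in> A" "q \<in> A" if "(p, q) \<in> r" for p q
    using po that by (auto simp: partial_order_on_def preorder_on_def)
  have refl: "(p, p) \<in> r" if "p \<in> A" for p
    using po that by (auto simp: partial_order_on_def preorder_on_def refl_on_def)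
  have trans: "(p, s) \<in> r" if "(p, q) \<in> r" "(q, s) \<in> r" for p q s
    using po that by (auto simp: partial_order_on_def preorder_on_def dest: transD)
  have antisym: "p = q" if "(p, q) \<in> r" "(q, p) \<in> r" for p q
    using po that by (auto simp: partial_order_on_def dest: antisymD)
  define d where "d D p = (SOME x. x \<in> D \<and> (x, p) \<in> r)" for D p
  define c where
    "c p q = (if compatible_in A r p q then SOME s. (s, p) \<in> r \<and> (s, q) \<in> r else p)" for p q
  have d: "d D p \<in> D \<and> (d D p, p) \<in> r" if "D \<in> \<D>" "p \<in> A" for D p
  proof -
    have "\<exists>x. x \<in> D \<and> (x, p) \<in> r"
      using dense that unfolding dense_in_order_def by blast
    from someI_ex[OF this] show ?thesis by (simp add: d_def)
  qed
  have c: "(c p q, p) \<in> r \<and> (c p q, q) \<in> r" if "compatible_in A r p q" for p q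
  proof -
    have "\<exists>s. (s, p) \<in> r \<and> (s, q) \<in> r" using that by (auto simp: compatible_in_def)
    from someI_ex[OF this] show ?thesis using that by (simp add: c_def)
  qed
  have dA: "d D p \<in> A" if "D \<in> \<D>" "p \<in> A" for D p
    using d[OF that] rA by blast
  have cA: "c p q \<in> A" if "p \<in> A" "q \<in> A" for p q
    using c[of p q] rA that by (cases "compatible_in A r p q") (auto simp: c_def)
  obtain Q where Q: "a0 \<in> Q" "Q \<subseteq> A" "|Q| \<le>o omega1"
    and dQ: "\<And>D p. D \<in> \<D> \<Longrightarrow> p \<in> Q \<Longrightarrow> d D p \<in> Q"
    and cQ: "\<And>p q. p \<in> Q \<Longrightarrow> q \<in> Q \<Longrightarrow> c p q \<in> Q"
    using closed_subset_omega1[of \<D> a0 A d c] card a0 dA cA by metis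
  have "omega1 \<le>o omega2" by (rule cardSuc_ordLeq[OF Card_order_omega1])
  also have "omega2 =o |Field omega2|"
    by (rule ordIso_symmetric[OF card_of_Field_ordIso[OF Card_order_omega2]])
  also have "|Field omega2| \<le>o |UNIV :: nat set set set|" by (rule card_of_mono1) simp
  finally have "|Q| \<le>o |UNIV :: nat set set set|" using Q(3) ordLeq_transitive by blast
  then obtain f :: "'a \<Rightarrow> nat set set" where f: "inj_on f Q"
    by (auto simp flip: card_of_ordLeq)
  define s where "s = {(f p, f q) | p q. p \<in> Q \<and> q \<in> Q \<and> (p, q) \<in> r}"
  have s: "(f p, f q) \<in> s \<longleftrightarrow> (p, q) \<in> r" if "p \<in> Q" "q \<in> Q" for p q
    using that f by (auto simp: s_def inj_on_eq_iff)
  have po': "partial_order_on (f ` Q) s"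
    unfolding partial_order_on_def preorder_on_def
  proof (intro conjI)
    show "s \<subseteq> f ` Q \<times> f ` Q" by (auto simp: s_def)
    show "refl_on (f ` Q) s" using Q refl by (auto simp: refl_on_def s)
    show "trans s"
    proof (rule transI)
      fix x y z assume xyz: "(x, y) \<in> s" "(y, z) \<in> s"
      then obtain p q t where "p \<in> Q" "q \<in> Q" "t \<in> Q" "x = f p" "y = f q" "z = f t"
        by (auto simp: s_def)
      with xyz show "(x, z) \<in> s" using trans[of p q t] by (simp add: s)
    qed
    show "antisym s"
    proof (rule antisymI)
      fix x y assume xy: "(x, y) \<in> s" "(y, x) \<in> s"
      then obtain p q where "p \<in> Q" "q \<in> Q" "x = f p" "y = f q" by (auto simp: s_def)
      with xy show "x = y" using antisym[of p q] by (simp add: s)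
    qed
  qed
  have compat: "compatible_in (f ` Q) s (f p) (f q)"
    if "p \<in> Q" "q \<in> Q" "compatible_in A r p q" for p q
    using c[OF that(3)] cQ[OF that(1,2)] that(1,2)
    by (auto simp: compatible_in_def s intro!: bexI[of _ "c p q"])
  have ccc': "ccc (f ` Q) s"
    unfolding ccc_def
  proof (intro allI impI)
    fix C assume C: "antichain_in (f ` Q) s C"
    then obtain B where B: "B \<subseteq> Q" "C = f ` B"
      by (auto simp: antichain_in_def subset_image_iff)
    have "antichain_in A r B"
      unfolding antichain_in_def
    proof (intro conjI ballI impI)
      show "B \<subseteq> A" using B Q by blast
      fix p q assume pq: "p \<in> B" "q \<in> B" "p \<noteq> q"
      then have "p \<in> Q" "q \<in> Q" using B by auto
      then have "f p \<noteq> f q" using f pq by (simp add: inj_on_eq_iff)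
      then show "\<not> compatible_in A r p q"
        using compat[of p q] C pq B \<open>p \<in> Q\<close> \<open>q \<in> Q\<close> by (auto simp: antichain_in_def)
    qed
    then show "countable C" using ccc B by (simp add: ccc_def)
  qed
  define \<E> where "\<E> = (\<lambda>D. f ` (D \<inter> Q)) ` \<D>"
  have "|\<E>| \<le>o omega1"
    unfolding \<E>_def using card_of_image card by (rule ordLeq_transitive)
  moreover have "\<forall>E\<in>\<E>. dense_in_order (f ` Q) s E"
    unfolding \<E>_def dense_in_order_def
  proof (intro ballI conjI, goal_cases)
    case (2 E p)
    then obtain D x where D: "D \<in> \<D>" "E = f ` (D \<inter> Q)" "x \<in> Q" "p = f x" by auto
    then have "d D x \<in> D \<inter> Q" "(f (d D x), f x) \<in> s"
      using d[of D x] dQ[of D x] Q by (auto simp: s)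
    then show ?case using D by blast
  qed auto
  ultimately obtain G where G: "filter_in_order (f ` Q) s G" "\<forall>E\<in>\<E>. G \<inter> E \<noteq> {}"
    using MA Q(1) po' ccc' unfolding MA_omega1_def by (metis empty_iff image_eqI)
  define H where "H = {p \<in> A. \<exists>g\<in>Q. f g \<in> G \<and> (g, p) \<in> r}"
  have GH: "g \<in> H" if "g \<in> Q" "f g \<in> G" for g
    using that Q refl by (auto simp: H_def)
  have "filter_in_order A r H"
    unfolding filter_in_order_def
  proof (intro conjI ballI impI)
    show "H \<subseteq> A" by (auto simp: H_def)
    show "H \<noteq> {}" using G(1) GH unfolding filter_in_order_def by blast
    show "q \<in> H" if "p \<in> H" "q \<in> A" "(p, q) \<in> r" for p q
      using that trans by (auto simp: H_def)
    fix p q assume "p \<in> H" "q \<in> H"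
    then obtain x y where xy: "x \<in> Q" "f x \<in> G" "(x, p) \<in> r" "y \<in> Q" "f y \<in> G" "(y, q) \<in> r"
      by (auto simp: H_def)
    then obtain z where z: "z \<in> G" "(z, f x) \<in> s" "(z, f y) \<in> s"
      using G(1) unfolding filter_in_order_def by blast
    then obtain w where w: "w \<in> Q" "z = f w"
      using G(1) unfolding filter_in_order_def by blast
    with z xy have "(w, x) \<in> r" "(w, y) \<in> r" by (auto simp: s)
    with xy have "(w, p) \<in> r" "(w, q) \<in> r" using trans by blast+
    moreover have "w \<in> H" using GH w z by blast
    ultimately show "\<exists>s\<in>H. (s, p) \<in> r \<and> (s, q) \<in> r" by blast
  qed
  moreover have "H \<inter> D \<noteq> {}" if D: "D \<in> \<D>" for D
  proof -
    from D have "G \<inter> f ` (D \<inter> Q) \<noteq> {}" using G(2) by (auto simp: \<E>_def)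
    then show ?thesis using GH by blast
  qed
  ultimately show "\<exists>G. filter_in_order A r G \<and> (\<forall>D\<in>\<D>. G \<inter> D \<noteq> {})" by blast
qed


section \<open>\<open>G\<^sub>\<delta>\<close>-modification\<close>

definition Gdelta_modification :: "'a topology \<Rightarrow> 'a topology" where
  "Gdelta_modification X = topology (arbitrary union_of gdelta_in X)"

lemma openin_Gdelta_modification:
  "openin (Gdelta_modification X) = arbitrary union_of gdelta_in X"
  unfolding Gdelta_modification_def
  by (rule topology_inverse') (rule istopology_base, rule gdelta_in_Int)

lemma topspace_Gdelta_modification [simp]:
  "topspace (Gdelta_modification X) = topspace X"
proof (rule antisym)
  show "topspace (Gdelta_modification X) \<subseteq> topspace X"
  proof -
    obtain \<U> where "\<U> \<subseteq> Collect (gdelta_in X)" "\<Union>\<U> = topspace (Gdelta_modification X)"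
      using openin_topspace[of "Gdelta_modification X"]
      by (auto simp: openin_Gdelta_modification union_of_def)
    then show ?thesis using gdelta_in_subset[of X] by blast
  qed
  have "openin (Gdelta_modification X) (topspace X)"
    unfolding openin_Gdelta_modification
    by (rule union_of_inc) (auto simp: arbitrary_def open_imp_gdelta_in)
  then show "topspace X \<subseteq> topspace (Gdelta_modification X)" by (rule openin_subset)
qed


section \<open>Tightness\<close>

text \<open>Cardinals are represented by relations satisfying \<open>Card_order\<close>. That the candidates live on
  \<open>'a\<close> is no restriction: in both uses below the cardinality of the space is an upper bound, and
  the minimality statements in \<open>point_tightness(3)\<close> and \<open>tightness(3)\<close> hold for cardinals
  on any type.\<close>

definition least_cardinal :: "('a rel \<Rightarrow> bool) \<Rightarrow> 'a rel" where
  "least_cardinal P = (SOME \<kappa>. Card_order \<kappa> \<and> P \<kappa> \<and> (\<forall>\<mu>. Card_order \<mu> \<and> P \<mu> \<longrightarrow> \<kappa> \<le>o \<mu>))"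

definition point_tightness :: "'a topology \<Rightarrow> 'a \<Rightarrow> 'a rel" where
  "point_tightness X x = least_cardinal (\<lambda>\<kappa>. \<forall>A \<subseteq> topspace X. x \<in> X closure_of A \<longrightarrow>
     (\<exists>B \<subseteq> A. |B| \<le>o \<kappa> \<and> x \<in> X closure_of B))"

definition tightness :: "'a topology \<Rightarrow> 'a rel" where
  "tightness X = least_cardinal (\<lambda>\<kappa>. \<forall>x\<in>topspace X. point_tightness X x \<le>o \<kappa>)"

lemma least_cardinal:
  assumes "Card_order \<kappa>" "P \<kappa>"
  shows "Card_order (least_cardinal P)" "P (least_cardinal P)"
    and "\<And>\<mu>. Card_order \<mu> \<Longrightarrow> P \<mu> \<Longrightarrow> least_cardinal P \<le>o \<mu>"
proof -
  have "\<exists>\<kappa>. Card_order \<kappa> \<and> P \<kappa> \<and> (\<forall>\<mu>. Card_order \<mu> \<and> P \<mu> \<longrightarrow> \<kappa> \<le>o \<mu>)"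
    using exists_minim_Card_order[of "{\<kappa>. Card_order \<kappa> \<and> P \<kappa>}"] assms by blast
  from someI_ex[OF this]
  show "Card_order (least_cardinal P)" "P (least_cardinal P)"
    "\<And>\<mu>. Card_order \<mu> \<Longrightarrow> P \<mu> \<Longrightarrow> least_cardinal P \<le>o \<mu>"
    by (auto simp: least_cardinal_def)
qed

lemma cardinal_on_type_cases:
  fixes \<mu> :: "'b rel"
  assumes "Card_order \<mu>"
  obtains (iso) \<kappa> :: "'a rel" where "Card_order \<kappa>" "\<kappa> =o \<mu>" | (large) "|UNIV :: 'a set| \<le>o \<mu>"
proof -
  have F: "|Field \<mu>| =o \<mu>" using assms by (rule card_of_Field_ordIso)
  consider "|Field \<mu>| \<le>o |UNIV :: 'a set|" | "|UNIV :: 'a set| \<le>o |Field \<mu>|"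
    using ordLeq_total[of "|Field \<mu>|" "|UNIV :: 'a set|"] card_of_Well_order by metis
  then show thesis
  proof cases
    case 1
    then obtain f :: "'b \<Rightarrow> 'a" where "inj_on f (Field \<mu>)" by (auto simp flip: card_of_ordLeq)
    then have "|Field \<mu>| =o |f ` Field \<mu>|"
      using card_of_ordIso inj_on_imp_bij_betw by blast
    then have "|f ` Field \<mu>| =o \<mu>" using F ordIso_symmetric ordIso_transitive by blast
    then show thesis using iso card_of_Card_order by blast
  next
    case 2
    then show thesis using large F ordLeq_ordIso_trans by blast
  qed
qed

lemma card_topspace_bounds_point_tightness:
  "\<forall>A \<subseteq> topspace X. x \<in> X closure_of A \<longrightarrow>
     (\<exists>B \<subseteq> A. |B| \<le>o |topspace X| \<and> x \<in> X closure_of B)"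
  using card_of_mono1 by blast

lemma point_tightness:
  fixes X :: "'a topology" and \<mu> :: "'b rel"
  shows "Card_order (point_tightness X x)"
    and "\<lbrakk>A \<subseteq> topspace X; x \<in> X closure_of A\<rbrakk> \<Longrightarrow>
           \<exists>B \<subseteq> A. |B| \<le>o point_tightness X x \<and> x \<in> X closure_of B"
    and "\<lbrakk>Card_order \<mu>; \<And>A. \<lbrakk>A \<subseteq> topspace X; x \<in> X closure_of A\<rbrakk> \<Longrightarrow>
           \<exists>B \<subseteq> A. |B| \<le>o \<mu> \<and> x \<in> X closure_of B\<rbrakk> \<Longrightarrow> point_tightness X x \<le>o \<mu>"
proof -
  note * = least_cardinal[where P = "\<lambda>\<kappa>. \<forall>A \<subseteq> topspace X. x \<in> X closure_of A \<longrightarrow>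
          (\<exists>B \<subseteq> A. |B| \<le>o \<kappa> \<and> x \<in> X closure_of B)",
      OF card_of_Card_order card_topspace_bounds_point_tightness, folded point_tightness_def]
  show "Card_order (point_tightness X x)" by (rule *(1))
  show "\<exists>B \<subseteq> A. |B| \<le>o point_tightness X x \<and> x \<in> X closure_of B"
    if "A \<subseteq> topspace X" "x \<in> X closure_of A"
    using *(2) that by simp
  show "point_tightness X x \<le>o \<mu>"
    if "Card_order \<mu>" "\<And>A. \<lbrakk>A \<subseteq> topspace X; x \<in> X closure_of A\<rbrakk> \<Longrightarrow>
           \<exists>B \<subseteq> A. |B| \<le>o \<mu> \<and> x \<in> X closure_of B"
    for \<mu> :: "'b rel"
    using that(1)
  proof (cases rule: cardinal_on_type_cases[where 'a = 'a])
    case (iso \<kappa>)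
    have "\<forall>A \<subseteq> topspace X. x \<in> X closure_of A \<longrightarrow>
            (\<exists>B \<subseteq> A. |B| \<le>o \<kappa> \<and> x \<in> X closure_of B)"
      using that(2) ordLeq_ordIso_trans[OF _ ordIso_symmetric[OF iso(2)]] by meson
    then have "point_tightness X x \<le>o \<kappa>" by (rule *(3)[OF iso(1)])
    then show ?thesis using iso(2) by (rule ordLeq_ordIso_trans)
  next
    case large
    have "point_tightness X x \<le>o |topspace X|"
      by (rule *(3)[OF card_of_Card_order card_topspace_bounds_point_tightness])
    then show ?thesis
      using card_of_mono1[OF subset_UNIV] large by (meson ordLeq_transitive)
  qed
qed

lemma tightness:
  fixes X :: "'a topology" and \<mu> :: "'b rel"
  shows "Card_order (tightness X)"
    and "x \<in> topspace X \<Longrightarrow> point_tightness X x \<le>o tightness X"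
    and "\<lbrakk>Card_order \<mu>; \<And>x. x \<in> topspace X \<Longrightarrow> point_tightness X x \<le>o \<mu>\<rbrakk> \<Longrightarrow>
           tightness X \<le>o \<mu>"
proof -
  have le: "\<forall>x\<in>topspace X. point_tightness X x \<le>o |topspace X|"
    by (intro ballI point_tightness(3) card_of_Card_order
        card_topspace_bounds_point_tightness[rule_format])
  note * = least_cardinal[where P = "\<lambda>\<kappa>. \<forall>x\<in>topspace X. point_tightness X x \<le>o \<kappa>",
      OF card_of_Card_order le, folded tightness_def]
  show "Card_order (tightness X)" by (rule *(1))
  show "point_tightness X x \<le>o tightness X" if "x \<in> topspace X"
    using *(2) that by simp
  show "tightness X \<le>o \<mu>"
    if "Card_order \<mu>" "\<And>x. x \<in> topspace X \<Longrightarrow> point_tightness X x \<le>o \<mu>"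
    for \<mu> :: "'b rel"
    using that(1)
  proof (cases rule: cardinal_on_type_cases[where 'a = 'a])
    case (iso \<kappa>)
    have "\<forall>x\<in>topspace X. point_tightness X x \<le>o \<kappa>"
      using that(2) ordLeq_ordIso_trans[OF _ ordIso_symmetric[OF iso(2)]] by blast
    then have "tightness X \<le>o \<kappa>" by (rule *(3)[OF iso(1)])
    then show ?thesis using iso(2) by (rule ordLeq_ordIso_trans)
  next
    case large
    have "tightness X \<le>o |topspace X|" by (rule *(3)[OF card_of_Card_order le])
    then show ?thesis
      using card_of_mono1[OF subset_UNIV] large by (meson ordLeq_transitive)
  qed
qed


section \<open>Frechet spaces\<close>

definition Frechet_space :: "'a topology \<Rightarrow> bool" where
  "Frechet_space X \<longleftrightarrow> (\<forall>x\<in>topspace X. \<forall>A \<subseteq> topspace X.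
     x \<in> X closure_of A \<longleftrightarrow> (\<exists>s :: nat \<Rightarrow> 'a. range s \<subseteq> A \<and> limitin X s x sequentially))"

end

theory Submission
  imports Defs "HOL-Library.Countable_Set_Type"
begin

text \<open>
  All points except the top point are isolated, and the neighbourhoods of the top point are the sets
  that contain almost all of each member of a family \<open>S\<close> of subsets of \<open>\<omega>\<^sub>2\<close> of order type \<open>\<omega>\<close>
  (``ladders''). Such a topology is always Frechet: a set without a sequence converging to the top is almost
  disjoint from all ladders, so its complement is a neighbourhood. The top is outside the
  \<open>G\<^sub>\<delta>\<close>-closure of \<open>A\<close> iff some \<open>f : A \<rightarrow> \<omega>\<close> is finite-to-one on all ladders. So \<open>S\<close> should admit such an
  \<open>f\<close> on every \<open>\<alpha> < \<omega>\<^sub>2\<close> but not on \<open>\<omega>\<^sub>2\<close>.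

  The first requirement holds, by Martin's axiom and induction on \<open>\<alpha>\<close>, as soon as each \<open>\<alpha>\<close> contains at most
  \<open>\<omega>\<^sub>1\<close> ladders. A family with the second property is obtained from \<open>2\<^bsup>\<omega>\<^sub>1\<^esup> = \<omega>\<^sub>2\<close> by the argument with
  which Shelah derives the diamond principle.
\<close>

section \<open>The ordinals below \<open>\<omega>\<^sub>1\<close> and \<open>\<omega>\<^sub>2\<close> as well-ordered types\<close>

typedef om1 = "Field omega1"
  using infinite_Field_omega1 by (metis ex_in_conv finite.emptyI)

typedef om2 = "Field omega2"
  using cardSuc_finite[OF Card_order_omega1] infinite_Field_omega1
  by (metis ex_in_conv finite.emptyI)

text \<open>The clauses are the axioms of class \<open>wellorder\<close> pulled back along
  \<open>Rep\<close>, so that both ordinals become types with \<open>LEAST\<close>, intervals and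
  induction.\<close>

lemma Card_order_transport:
  fixes Rep :: "'b \<Rightarrow> 'a"
  assumes r: "Card_order r" and inj: "inj Rep" and ran: "range Rep = Field r"
  shows "(Rep x, Rep x) \<in> r"
    and "(Rep x, Rep y) \<in> r \<Longrightarrow> (Rep y, Rep z) \<in> r \<Longrightarrow> (Rep x, Rep z) \<in> r"
    and "(Rep x, Rep y) \<in> r \<Longrightarrow> (Rep y, Rep x) \<in> r \<Longrightarrow> x = y"
    and "(Rep x, Rep y) \<in> r \<or> (Rep y, Rep x) \<in> r"
    and "(\<And>x. (\<And>y. (Rep y, Rep x) \<in> r \<and> \<not> (Rep x, Rep y) \<in> r \<Longrightarrow> P y) \<Longrightarrow> P x) \<Longrightarrow> P a"
proof -
  have W: "Well_order r" using r by (simp add: card_order_on_def)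
  interpret wo_rel r by (simp add: wo_rel_def W)
  have F: "Rep x \<in> Field r" for x using ran by auto
  show "(Rep x, Rep x) \<in> r" using REFL F by (simp add: refl_on_def)
  show "(Rep x, Rep y) \<in> r \<Longrightarrow> (Rep y, Rep z) \<in> r \<Longrightarrow> (Rep x, Rep z) \<in> r"
    using TRANS by (blast dest: transD)
  show "(Rep x, Rep y) \<in> r \<Longrightarrow> (Rep y, Rep x) \<in> r \<Longrightarrow> x = y"
    using ANTISYM inj by (blast dest: antisymD injD)
  show "(Rep x, Rep y) \<in> r \<or> (Rep y, Rep x) \<in> r"
    using TOTALS F by blast
  have "wf (inv_image (r - Id) Rep)" using WF by simp
  then show "P a" if "\<And>x. (\<And>y. (Rep y, Rep x) \<in> r \<and> \<not> (Rep x, Rep y) \<in> r \<Longrightarrow> P y) \<Longrightarrow> P x"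
  proof (induction a rule: wf_induct_rule)
    case (less a)
    show ?case
    proof (rule that)
      fix y assume "(Rep y, Rep a) \<in> r \<and> \<not> (Rep a, Rep y) \<in> r"
      then show "P y" by (intro less) auto
    qed
  qed
qed

lemma om1_iso: "inj Rep_om1" "range Rep_om1 = Field omega1"
  by (auto simp: inj_def Rep_om1_inject type_definition.Rep_range[OF type_definition_om1])

lemma om2_iso: "inj Rep_om2" "range Rep_om2 = Field omega2"
  by (auto simp: inj_def Rep_om2_inject type_definition.Rep_range[OF type_definition_om2])

instantiation om1 :: wellorder
begin
definition "x \<le> y \<longleftrightarrow> (Rep_om1 x, Rep_om1 y) \<in> omega1"
definition "x < y \<longleftrightarrow> (Rep_om1 x, Rep_om1 y) \<in> omega1 \<and> (Rep_om1 y, Rep_om1 x) \<notin> omega1"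
instance
proof
  note wo = Card_order_transport[OF Card_order_omega1 om1_iso]
  fix x y z :: om1
  show "x < y \<longleftrightarrow> x \<le> y \<and> \<not> y \<le> x" by (simp add: less_eq_om1_def less_om1_def)
  show "x \<le> x" using wo(1) by (simp add: less_eq_om1_def)
  show "x \<le> z" if "x \<le> y" "y \<le> z" using wo(2) that unfolding less_eq_om1_def .
  show "x = y" if "x \<le> y" "y \<le> x" using wo(3) that unfolding less_eq_om1_def .
  show "x \<le> y \<or> y \<le> x" using wo(4) by (simp add: less_eq_om1_def)
  show "P x" if "\<And>x. (\<And>y. y < x \<Longrightarrow> P y) \<Longrightarrow> P x" for P
    using that unfolding less_om1_def by (rule wo(5))
qed
end

instantiation om2 :: wellorder
begin
definition "x \<le> y \<longleftrightarrow> (Rep_om2 x, Rep_om2 y) \<in> omega2"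
definition "x < y \<longleftrightarrow> (Rep_om2 x, Rep_om2 y) \<in> omega2 \<and> (Rep_om2 y, Rep_om2 x) \<notin> omega2"
instance
proof
  note wo = Card_order_transport[OF Card_order_omega2 om2_iso]
  fix x y z :: om2
  show "x < y \<longleftrightarrow> x \<le> y \<and> \<not> y \<le> x" by (simp add: less_eq_om2_def less_om2_def)
  show "x \<le> x" using wo(1) by (simp add: less_eq_om2_def)
  show "x \<le> z" if "x \<le> y" "y \<le> z" using wo(2) that unfolding less_eq_om2_def .
  show "x = y" if "x \<le> y" "y \<le> x" using wo(3) that unfolding less_eq_om2_def .
  show "x \<le> y \<or> y \<le> x" using wo(4) by (simp add: less_eq_om2_def)
  show "P x" if "\<And>x. (\<And>y. y < x \<Longrightarrow> P y) \<Longrightarrow> P x" for P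
    using that unfolding less_om2_def by (rule wo(5))
qed
end

section \<open>Cardinality and regularity of the two ordinals\<close>

lemma card_of_om1: "|UNIV :: om1 set| =o omega1"
proof -
  have "|UNIV :: om1 set| =o |Field omega1|"
    using om1_iso by (intro card_of_ordIsoI[of Rep_om1]) (simp add: bij_betw_def)
  then show ?thesis
    using card_of_Field_ordIso[OF Card_order_omega1] by (rule ordIso_transitive)
qed

lemma card_of_om2: "|UNIV :: om2 set| =o omega2"
proof -
  have "|UNIV :: om2 set| =o |Field omega2|"
    using om2_iso by (intro card_of_ordIsoI[of Rep_om2]) (simp add: bij_betw_def)
  then show ?thesis
    using card_of_Field_ordIso[OF Card_order_omega2] by (rule ordIso_transitive)
qed

lemma infinite_om1: "infinite (UNIV :: om1 set)"
  using om1_iso infinite_Field_omega1 finite_imageI[of UNIV Rep_om1] by auto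

lemma uncountable_om1: "uncountable (UNIV :: om1 set)"
proof
  assume "countable (UNIV :: om1 set)"
  then have "omega1 \<le>o natLeq"
    unfolding countable_card_le_natLeq by (rule ordIso_ordLeq_trans[OF ordIso_symmetric[OF card_of_om1]])
  then show False
    using cardSuc_greater[OF natLeq_Card_order] not_ordLess_ordLeq by blast
qed

lemma countable_initial_om1: "countable {..<x :: om1}"
proof -
  have "|underS omega1 (Rep_om1 x)| <o omega1"
    using Card_order_omega1 Rep_om1 by (rule card_of_underS)
  then have "countable (underS omega1 (Rep_om1 x))"
    using cardSuc_ordLeq_ordLess[OF natLeq_Card_order card_of_Card_order]
    by (auto simp: countable_card_le_natLeq)
  moreover have "inj_on Rep_om1 {..<x}" using om1_iso(1) inj_on_subset by blast
  moreover have "Rep_om1 ` {..<x} \<subseteq> underS omega1 (Rep_om1 x)"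
    by (auto simp: underS_def less_om1_def Card_order_omega1 om1_iso)
  ultimately show ?thesis by (metis countable_image_inj_on countable_subset)
qed

text \<open>Regularity of omega_1: an unbounded countable set would cover the type by countably many
  countable segments.\<close>

lemma bounded_om1:
  fixes A :: "om1 set"
  assumes "countable A"
  shows "\<exists>b. \<forall>a\<in>A. a < b"
proof (rule ccontr)
  assume "\<not> ?thesis"
  then have "\<forall>b. \<exists>a\<in>A. b \<le> a" by (simp add: not_less)
  then have "UNIV = (\<Union>a\<in>A. insert a {..<a})" by (auto simp: order_le_less)
  moreover have "countable (\<Union>a\<in>A. insert a {..<a})"
    using assms countable_initial_om1 by simp
  ultimately show False using uncountable_om1 by simp
qed

lemma card_initial_om2: "|{..x :: om2}| \<le>o |UNIV :: om1 set|"
proof -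
  have "|underS omega2 (Rep_om2 x)| <o omega2"
    using Card_order_omega2 Rep_om2 by (rule card_of_underS)
  then have "|underS omega2 (Rep_om2 x)| \<le>o omega1"
    using cardSuc_ordLeq_ordLess[OF Card_order_omega1 card_of_Card_order] by blast
  moreover have "|{..<x}| \<le>o |underS omega2 (Rep_om2 x)|"
    using om2_iso(1) unfolding card_of_ordLeq[symmetric]
    by (intro exI[of _ Rep_om2]) (auto simp: underS_def less_om2_def inj_on_def)
  ultimately have "|{..<x}| \<le>o |UNIV :: om1 set|"
    by (meson card_of_om1 ordIso_symmetric ordLeq_ordIso_trans ordLeq_transitive)
  moreover have "|{x}| \<le>o |UNIV :: om1 set|"
    by (rule card_of_singl_ordLeq) simp
  ultimately have "|{..<x} \<union> {x}| \<le>o |UNIV :: om1 set|"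
    using infinite_om1
    by (intro card_of_Un_ordLeq_infinite_Field card_of_Card_order) (simp add: Field_card_of)
  then show ?thesis by (simp only: ivl_disj_un_singleton)
qed

text \<open>The closed segment is nonempty, so the cardinality bound yields a surjection.\<close>

lemma initial_om2_surj:
  obtains e :: "om1 \<Rightarrow> om2" where "range e = {..x}"
  using card_initial_om2[of x] card_of_ordLeq2[of "{..x}" "UNIV :: om1 set"] by auto

text \<open>Regularity of omega_2, again by covering the type with too few small segments.\<close>

lemma bounded_om2:
  fixes A :: "om2 set"
  assumes "|A| \<le>o |UNIV :: om1 set|"
  shows "\<exists>b. \<forall>a\<in>A. a < b"
proof (rule ccontr)
  assume "\<not> ?thesis"
  then have "\<forall>b. \<exists>a\<in>A. b \<le> a" by (simp add: not_less)
  then have "UNIV = (\<Union>a\<in>A. {..a})" by auto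
  moreover have "|\<Union>a\<in>A. {..a}| \<le>o |UNIV :: om1 set|"
    using assms card_initial_om2 by (intro card_of_UNION_ordLeq_infinite infinite_om1) auto
  ultimately have "|UNIV :: om2 set| \<le>o |UNIV :: om1 set|" by simp
  then have "omega2 \<le>o omega1"
    by (rule ordIso_ordLeq_trans[OF ordIso_symmetric[OF card_of_om2]
          ordLeq_ordIso_trans[OF _ card_of_om1]])
  then show False
    using cardSuc_greater[OF Card_order_omega1] not_ordLess_ordLeq by blast
qed

lemma bounded_om2_range:
  fixes f :: "om1 \<Rightarrow> om2"
  shows "\<exists>b. \<forall>x. f x < b"
  using bounded_om2[OF card_of_image[of f UNIV]] by simp

section \<open>Ladders and the countable chain condition\<close>

text \<open>Sets of order type at most \<open>\<omega>\<close>.\<close>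

definition ladder :: "'a::linorder set \<Rightarrow> bool" where
  "ladder s \<longleftrightarrow> (\<forall>x\<in>s. finite (s \<inter> {..<x}))"

lemma ladder_countable:
  assumes "ladder s"
  shows "countable s"
proof (rule countableI)
  show "inj_on (\<lambda>x. card (s \<inter> {..<x})) s"
  proof (rule linorder_inj_onI')
    fix x y assume xy: "x \<in> s" "y \<in> s" "x < y"
    then have "s \<inter> {..<x} \<subset> s \<inter> {..<y}" by auto
    moreover have "finite (s \<inter> {..<y})" using assms xy by (simp add: ladder_def)
    ultimately have "card (s \<inter> {..<x}) < card (s \<inter> {..<y})" by (metis psubset_card_mono)
    then show "card (s \<inter> {..<x}) \<noteq> card (s \<inter> {..<y})" by simp
  qed
qed

section \<open>Delta systems of finite sets\<close>

text \<open>Zorn's lemma gives a maximal disjoint subfamily. Were it countable, its union would meet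
  only countably many \<open>F i\<close>, and another index could be added.\<close>

lemma uncountable_disjoint_subfamily:
  assumes I: "uncountable I" and F: "\<And>i. i \<in> I \<Longrightarrow> countable (F i)"
    and few: "\<And>x. countable {i\<in>I. x \<in> F i}"
  obtains J where "J \<subseteq> I" "uncountable J" "disjoint_family_on F J"
proof -
  define \<C> where "\<C> = {J. J \<subseteq> I \<and> disjoint_family_on F J}"
  have "\<exists>M\<in>\<C>. \<forall>X\<in>\<C>. M \<subseteq> X \<longrightarrow> X = M"
  proof (rule subset_Zorn_nonempty)
    have "{} \<in> \<C>" by (simp add: \<C>_def disjoint_family_on_def)
    then show "\<C> \<noteq> {}" by blast
    fix \<K> assume \<K>: "\<K> \<noteq> {}" "subset.chain \<C> \<K>"
    then have sub: "\<K> \<subseteq> \<C>" and chain: "\<And>X Y. X \<in> \<K> \<Longrightarrow> Y \<in> \<K> \<Longrightarrow> X \<subseteq> Y \<or> Y \<subseteq> X"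
      by (auto simp: subset_chain_def)
    have "F m \<inter> F n = {}"
      if mn: "m \<in> X" "n \<in> Y" "X \<in> \<K>" "Y \<in> \<K>" and "m \<noteq> n" for m n X Y
    proof -
      obtain Z where "Z \<in> \<K>" "m \<in> Z" "n \<in> Z" using chain mn by blast
      then show ?thesis using sub \<open>m \<noteq> n\<close> unfolding \<C>_def disjoint_family_on_def by blast
    qed
    then have "disjoint_family_on F (\<Union>\<K>)" unfolding disjoint_family_on_def by blast
    moreover have "\<Union>\<K> \<subseteq> I" using sub by (auto simp: \<C>_def)
    ultimately show "\<Union>\<K> \<in> \<C>" by (simp add: \<C>_def)
  qed
  then obtain M where M: "M \<in> \<C>" and max: "\<And>X. X \<in> \<C> \<Longrightarrow> M \<subseteq> X \<Longrightarrow> X = M" by blast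
  have "uncountable M"
  proof
    assume cM: "countable M"
    have "countable (\<Union>i\<in>M. F i)" using cM F M by (auto simp: \<C>_def)
    then have "countable (\<Union>x\<in>\<Union>i\<in>M. F i. {i\<in>I. x \<in> F i})"
      by (rule countable_UN) (rule few)
    then have "countable (M \<union> (\<Union>x\<in>\<Union>i\<in>M. F i. {i\<in>I. x \<in> F i}))"
      using cM by simp
    then have "\<not> I \<subseteq> M \<union> (\<Union>x\<in>\<Union>i\<in>M. F i. {i\<in>I. x \<in> F i})" using I countable_subset by blast
    then obtain i where i: "i \<in> I" "i \<notin> M" "F i \<inter> (\<Union>i\<in>M. F i) = {}" by blast
    then have "disjoint_family_on F (insert i M)"
      using M unfolding \<C>_def disjoint_family_on_def by blast
    then have "insert i M \<in> \<C>" using i M by (simp add: \<C>_def)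
    with max i show False by blast
  qed
  then show ?thesis using M that by (auto simp: \<C>_def)
qed

text \<open>Induction on the common size. A point lying in uncountably many sets is removed and
  returned to the root; if there is none, an uncountable disjoint subfamily exists and the root is
  empty.\<close>

lemma delta_system_card:
  assumes "uncountable I" "\<And>i. i \<in> I \<Longrightarrow> finite (F i) \<and> card (F i) = n"
  shows "\<exists>J R. J \<subseteq> I \<and> uncountable J \<and> (\<forall>i\<in>J. R \<subseteq> F i) \<and> disjoint_family_on (\<lambda>i. F i - R) J"
  using assms
proof (induction n arbitrary: I F)
  case 0
  then have "F i = {}" if "i \<in> I" for i using that by fastforce
  then have "disjoint_family_on (\<lambda>i. F i - {}) I" by (simp add: disjoint_family_on_def)
  with 0 show ?case by blast
next
  case (Suc n)
  show ?case
  proof (cases "\<exists>x. uncountable {i\<in>I. x \<in> F i}")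
    case True
    then obtain x where x: "uncountable {i\<in>I. x \<in> F i}" ..
    have "\<exists>J R. J \<subseteq> {i\<in>I. x \<in> F i} \<and> uncountable J \<and> (\<forall>i\<in>J. R \<subseteq> F i - {x}) \<and>
        disjoint_family_on (\<lambda>i. F i - {x} - R) J"
      using x Suc.prems(2) by (intro Suc.IH) auto
    then obtain J R where JR: "J \<subseteq> {i\<in>I. x \<in> F i}" "uncountable J" "\<forall>i\<in>J. R \<subseteq> F i - {x}"
        "disjoint_family_on (\<lambda>i. F i - {x} - R) J" by (elim exE conjE) (rule that)
    have "F i - {x} - R = F i - insert x R" for i by blast
    with JR show ?thesis by (intro exI[of _ J] exI[of _ "insert x R"]) auto
  next
    case False
    then obtain J where "J \<subseteq> I" "uncountable J" "disjoint_family_on F J"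
      using uncountable_disjoint_subfamily[OF Suc.prems(1), of F] Suc.prems(2)
      by (metis countable_finite)
    then show ?thesis by (intro exI[of _ J] exI[of _ "{}"]) auto
  qed
qed

lemma uncountable_fibre:
  assumes "uncountable I" "countable K" "h ` I \<subseteq> K"
  obtains k where "uncountable {i\<in>I. h i = k}"
proof (rule ccontr)
  assume "\<not> thesis"
  then have "countable (\<Union>k\<in>K. {i\<in>I. h i = k})" using that assms(2) by blast
  moreover have "I \<subseteq> (\<Union>k\<in>K. {i\<in>I. h i = k})" using assms(3) by blast
  ultimately show False using assms(1) countable_subset by blast
qed

lemma delta_system:
  assumes I: "uncountable I" and F: "\<And>i. i \<in> I \<Longrightarrow> finite (F i)"
  obtains J R where "J \<subseteq> I" "uncountable J" "finite R" "disjoint_family_on (\<lambda>i. F i - R) J"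
proof -
  obtain n where n: "uncountable {i\<in>I. card (F i) = n}"
    using uncountable_fibre[OF I, of UNIV "\<lambda>i. card (F i)"] by auto
  have "\<exists>J R. J \<subseteq> {i\<in>I. card (F i) = n} \<and> uncountable J \<and> (\<forall>i\<in>J. R \<subseteq> F i) \<and>
      disjoint_family_on (\<lambda>i. F i - R) J"
    using n F by (intro delta_system_card[of _ _ n]) auto
  then obtain J R where JR: "J \<subseteq> {i\<in>I. card (F i) = n}" "uncountable J" "\<forall>i\<in>J. R \<subseteq> F i"
      "disjoint_family_on (\<lambda>i. F i - R) J" by (elim exE conjE) (rule that)
  then obtain i where "i \<in> J" by fastforce
  then have "R \<subseteq> F i" "finite (F i)" using JR F by auto
  then have "finite R" by (rule finite_subset)
  with JR that show ?thesis by blast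
qed

text \<open>A point of \<open>C\<close> lies in at most one member of the family.\<close>

lemma countable_meeting:
  assumes "disjoint_family_on F J" "countable C"
  shows "countable {j\<in>J. F j \<inter> C \<noteq> {}}"
proof -
  have "countable {j\<in>J. c \<in> F j}" for c
  proof (cases "{j\<in>J. c \<in> F j} = {}")
    case False
    then obtain j where "j \<in> J" "c \<in> F j" by auto
    then have "{j\<in>J. c \<in> F j} \<subseteq> {j}" using assms(1) by (auto simp: disjoint_family_on_def)
    then show ?thesis by (meson countable_finite finite.emptyI finite.insertI finite_subset)
  qed (metis countable_empty)
  then have "countable (\<Union>c\<in>C. {j\<in>J. c \<in> F j})" using assms(2) by blast
  moreover have "{j\<in>J. F j \<inter> C \<noteq> {}} = (\<Union>c\<in>C. {j\<in>J. c \<in> F j})" by auto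
  ultimately show ?thesis by simp
qed

text \<open>A set of order type \<open>\<omega>\<close> accumulates at no point below its supremum.\<close>

lemma ladder_accumulation_unique:
  fixes L :: "'a::wellorder set"
  assumes L: "ladder L" and "l < l'" "m < l"
    and acc: "\<And>y. y < l \<Longrightarrow> L \<inter> {y<..<l} \<noteq> {}" and acc': "L \<inter> {l<..<l'} \<noteq> {}"
  shows False
proof -
  obtain x where x: "x \<in> L" "l < x" using acc' by auto
  then have "finite (L \<inter> {..<x})" using L by (simp add: ladder_def)
  then have fin: "finite (L \<inter> {..<l})" by (rule rev_finite_subset) (use x in auto)
  \<comment> \<open>Nonempty because of \<open>m < l\<close>; the maximum would be a last point of
    \<open>L\<close> below \<open>l\<close>, against \<open>acc\<close>.\<close>
  have "L \<inter> {..<l} \<noteq> {}" using acc[OF \<open>m < l\<close>] by auto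
  with fin have "Max (L \<inter> {..<l}) \<in> L \<inter> {..<l}" by (rule Max_in)
  then have "L \<inter> {Max (L \<inter> {..<l})<..<l} \<noteq> {}" using acc by blast
  then obtain y where "y \<in> L" "Max (L \<inter> {..<l}) < y" "y < l" by auto
  then show False using fin by (meson IntI Max_ge lessThan_iff not_less)
qed

text \<open>If every two indices met, then some finite union of ladders \<open>W m\<close> would meet each \<open>F j\<close> with
  \<open>j\<close> in a countable set \<open>J0\<close> chosen so that these \<open>F j\<close> accumulate at infinitely many points.
  But each of the finitely many ladders accumulates at one point only.\<close>

lemma disjoint_from_ladders:
  fixes F :: "'i \<Rightarrow> om1 set" and W :: "'i \<Rightarrow> om1 set set"
  assumes J: "uncountable J" and F: "\<And>i. i \<in> J \<Longrightarrow> finite (F i)" "disjoint_family_on F J"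
    and W: "\<And>i. i \<in> J \<Longrightarrow> finite (W i)" "\<And>i L. i \<in> J \<Longrightarrow> L \<in> W i \<Longrightarrow> ladder L"
  obtains i j where "i \<in> J" "j \<in> J" "i \<noteq> j" "F i \<inter> \<Union>(W j) = {}" "F j \<inter> \<Union>(W i) = {}"
proof (rule ccontr)
  note found = that
  assume "\<not> thesis"
  then have meet: "F i \<inter> \<Union>(W j) \<noteq> {} \<or> F j \<inter> \<Union>(W i) \<noteq> {}"
    if ij: "i \<in> J" "j \<in> J" "i \<noteq> j" for i j
    using found[OF ij] by argo
  have cW: "countable (\<Union>(W i))" if i: "i \<in> J" for i
  proof -
    have "countable (\<Union>L\<in>W i. L)"
      using ladder_countable[OF W(2)[OF i]] by (rule countable_UN[OF countable_finite[OF W(1)[OF i]]])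
    then show ?thesis by simp
  qed
  \<comment> \<open>Two distinct indices with empty \<open>F\<close> would already be the desired
    pair.\<close>
  have countable_empties: "countable {j\<in>J. F j = {}}"
  proof (cases "{j\<in>J. F j = {}} = {}")
    case False
    then obtain i where "i \<in> J" "F i = {}" by auto
    then have "{j\<in>J. F j = {}} \<subseteq> {i}" using meet[of i] by auto
    then show ?thesis by (meson countable_finite finite.emptyI finite.insertI finite_subset)
  qed (metis countable_empty)
  have above: "\<exists>y'>y. \<exists>j\<in>J. F j \<noteq> {} \<and> F j \<subseteq> {y<..<y'}" for y
  proof -
    have "{..y} = insert y {..<y}" by (auto simp: order_le_less)
    then have "countable {..y}" using countable_initial_om1[of y] by simp
    then have "countable ({j\<in>J. F j = {}} \<union> {j\<in>J. F j \<inter> {..y} \<noteq> {}})"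
      by (rule countable_Un[OF countable_empties countable_meeting[OF F(2)]])
    then have "\<not> J \<subseteq> {j\<in>J. F j = {}} \<union> {j\<in>J. F j \<inter> {..y} \<noteq> {}}"
      using J by (meson countable_subset)
    then obtain j where j: "j \<in> J" "F j \<noteq> {}" "F j \<inter> {..y} = {}" by blast
    have "countable (insert y (F j))" using F(1)[OF j(1)] by (simp add: countable_finite)
    then obtain b where b: "\<forall>a\<in>insert y (F j). a < b" using bounded_om1 by blast
    then have "F j \<subseteq> {y<..<b}" using j(3) by (force simp: not_le[symmetric])
    then show ?thesis using b j(1,2) by blast
  qed
  \<comment> \<open>Whole nonempty sets \<open>F j\<close> occur arbitrarily close below a good
    \<open>l\<close>. The first conjunct excludes the least ordinal, where the second is
    vacuous.\<close>
  define good where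
    "good l \<longleftrightarrow> (\<exists>y. y < l) \<and> (\<forall>y<l. \<exists>j\<in>J. F j \<noteq> {} \<and> F j \<subseteq> {y<..<l})" for l
  have good_above: "\<exists>l>z. good l" for z
  proof -
    obtain nx where nx: "\<And>y. y < nx y \<and> (\<exists>j\<in>J. F j \<noteq> {} \<and> F j \<subseteq> {y<..<nx y})"
      using above by metis
    define u where "u n = (nx ^^ n) z" for n
    have uSuc: "u (Suc n) = nx (u n)" for n by (simp add: u_def)
    obtain b where b: "\<forall>n. u n < b" using bounded_om1[of "range u"] by auto
    \<comment> \<open>The supremum of \<open>u\<close>: any \<open>y < l\<close> is passed by some
      \<open>u n\<close>, and a whole \<open>F j\<close> lies between \<open>u n\<close> and
      \<open>u (Suc n)\<close>.\<close>
    define l where "l = (LEAST b. \<forall>n. u n < b)"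
    have ul: "u n < l" for n
      using LeastI[of "\<lambda>b. \<forall>n. u n < b" b] b by (simp add: l_def)
    have "\<exists>j\<in>J. F j \<noteq> {} \<and> F j \<subseteq> {y<..<l}" if "y < l" for y
    proof -
      obtain n where "y \<le> u n" using not_less_Least[of y "\<lambda>b. \<forall>n. u n < b"] \<open>y < l\<close>
        by (auto simp: l_def not_less)
      moreover obtain j where "j \<in> J" "F j \<noteq> {}" "F j \<subseteq> {u n<..<u (Suc n)}"
        using nx[of "u n"] uSuc by auto
      moreover have "u (Suc n) < l" by (rule ul)
      ultimately show ?thesis by (intro bexI[of _ j]) force+
    qed
    moreover have "z < l" using ul[of 0] by (simp add: u_def)
    ultimately show ?thesis by (auto simp: good_def)
  qed
  have "infinite {l. good l}"
  proof
    assume "finite {l. good l}"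
    then have "countable {l. good l}" by (rule countable_finite)
    then obtain b where "\<forall>l\<in>{l. good l}. l < b" using bounded_om1 by blast
    then show False using good_above[of b] by force
  qed
  then obtain \<Lambda> where \<Lambda>: "\<Lambda> \<subseteq> {l. good l}" "countable \<Lambda>" "infinite \<Lambda>"
    using infinite_countable_subset'[of "{l. good l}"] by blast
  have good: "\<exists>y. y < l" "\<And>y. y < l \<Longrightarrow> \<exists>j\<in>J. F j \<noteq> {} \<and> F j \<subseteq> {y<..<l}" if "l \<in> \<Lambda>" for l
    using \<Lambda>(1) that unfolding good_def by blast+
  obtain b where b: "\<forall>l\<in>\<Lambda>. l < b" using bounded_om1[OF \<Lambda>(2)] by blast
  \<comment> \<open>\<open>J0\<close> contains every index whose nonempty \<open>F j\<close> lies
    below a point of \<open>\<Lambda>\<close>; it is countable by disjointness.\<close>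
  define J0 where "J0 = {j\<in>J. F j \<inter> {..<b} \<noteq> {}}"
  have J0: "countable J0" "J0 \<subseteq> J"
    unfolding J0_def using countable_meeting[OF F(2) countable_initial_om1] by auto
  then have "countable (\<Union>j\<in>J0. \<Union>(W j))" using cW by (meson countable_UN subsetD)
  then have "countable (J0 \<union> {j\<in>J. F j \<inter> (\<Union>j\<in>J0. \<Union>(W j)) \<noteq> {}})"
    by (rule countable_Un[OF J0(1) countable_meeting[OF F(2)]])
  then have "\<not> J \<subseteq> J0 \<union> {j\<in>J. F j \<inter> (\<Union>j\<in>J0. \<Union>(W j)) \<noteq> {}}"
    using J by (meson countable_subset)
  \<comment> \<open>As \<open>F m\<close> avoids all ladders of \<open>J0\<close>,
    \<open>meet\<close> forces the ladders of \<open>m\<close> to hit every \<open>F j\<close> with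
    \<open>j\<close> in \<open>J0\<close>.\<close>
  then obtain m where m: "m \<in> J" "m \<notin> J0" "F m \<inter> (\<Union>j\<in>J0. \<Union>(W j)) = {}" by blast
  have hit: "F j \<inter> \<Union>(W m) \<noteq> {}" if "j \<in> J0" for j
  proof -
    have "F m \<inter> \<Union>(W j) = {}" using m(3) that by blast
    moreover have "j \<in> J" "m \<noteq> j" using that m(2) J0(2) by auto
    ultimately show ?thesis using meet[of m j] m(1) by simp
  qed
  \<comment> \<open>If no single ladder accumulated at \<open>l\<close>, then finitely many bounds
    would leave an interval below \<open>l\<close> free of all ladders of \<open>W m\<close>; but
    some \<open>F j\<close> lies there and is hit.\<close>
  have "\<exists>L\<in>W m. \<forall>y<l. L \<inter> {y<..<l} \<noteq> {}" if l: "l \<in> \<Lambda>" for l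
  proof (rule ccontr)
    assume "\<not> (\<exists>L\<in>W m. \<forall>y<l. L \<inter> {y<..<l} \<noteq> {})"
    then obtain Y where Y: "\<And>L. L \<in> W m \<Longrightarrow> Y L < l \<and> L \<inter> {Y L<..<l} = {}" by metis
    obtain y0 where y0: "y0 < l" using good(1)[OF l] by blast
    define y where "y = Max (insert y0 (Y ` W m))"
    have fin: "finite (insert y0 (Y ` W m))" using W m by simp
    then have "y \<in> insert y0 (Y ` W m)" unfolding y_def by (rule Max_in) simp
    then have "y < l" using Y y0 by auto
    then obtain j where j: "j \<in> J" "F j \<noteq> {}" "F j \<subseteq> {y<..<l}"
      using good(2)[OF l] by blast
    then have "j \<in> J0" using b l by (fastforce simp: J0_def)
    then obtain x L where x: "x \<in> F j" "L \<in> W m" "x \<in> L" using hit by blast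
    then have "Y L \<le> y" unfolding y_def using fin by (intro Max_ge) auto
    moreover have "y < x" "x < l" using x(1) j(3) by auto
    ultimately have "x \<in> L \<inter> {Y L<..<l}" using x(3) by simp
    then show False using Y x by blast
  qed
  then obtain Lad where Lad: "\<And>l. l \<in> \<Lambda> \<Longrightarrow> Lad l \<in> W m \<and> (\<forall>y<l. Lad l \<inter> {y<..<l} \<noteq> {})"
    by metis
  \<comment> \<open>Infinitely many accumulation points share finitely many ladders.\<close>
  have "\<not> inj_on Lad \<Lambda>"
    using Lad W(1)[OF m(1)] \<Lambda>(3) by (meson finite_imageD finite_subset image_subsetI)
  then obtain l l' where ll: "l \<in> \<Lambda>" "l' \<in> \<Lambda>" "l < l'" "Lad l = Lad l'"
    using linorder_inj_onI'[of \<Lambda> Lad] by metis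
  moreover obtain y0 where "y0 < l" using good(1)[OF ll(1)] by blast
  ultimately show False
    using ladder_accumulation_unique[of "Lad l" l l' y0] Lad[of l] Lad[of l'] W(2)[OF m(1)] by metis
qed

section \<open>Martin's axiom applied to finite approximations\<close>

lemma finite_to_one_on_ladders:
  fixes \<L> :: "om1 set set"
  assumes MA: "MA_omega1 TYPE(nat set set)"
    and card: "|\<L>| \<le>o |UNIV :: om1 set|" and lad: "\<And>L. L \<in> \<L> \<Longrightarrow> ladder L"
  shows "\<exists>g :: om1 \<Rightarrow> nat. \<forall>L\<in>\<L>. \<forall>n. finite {x\<in>L. g x = n}"
proof -
  txt \<open>A condition is a finite part \<open>p\<close> of \<open>g\<close> with a finite set \<open>w\<close> of promises; \<open>(L, n) \<in> w\<close> promises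
    that no further point of \<open>L\<close> gets the value \<open>n\<close>.\<close>
  define A :: "((om1 \<times> nat) set \<times> (om1 set \<times> nat) set) set" where
    "A = {(p, w). finite p \<and> single_valued p \<and> finite w \<and> fst ` w \<subseteq> \<L>}"
  define r where "r = {((p', w'), (p, w)). (p', w') \<in> A \<and> (p, w) \<in> A \<and> p \<subseteq> p' \<and> w \<subseteq> w' \<and>
     (\<forall>x n L. (x, n) \<in> p' - p \<longrightarrow> (L, n) \<in> w \<longrightarrow> x \<notin> L)}"
  have r_iff: "((p', w'), (p, w)) \<in> r \<longleftrightarrow> (p', w') \<in> A \<and> (p, w) \<in> A \<and> p \<subseteq> p' \<and> w \<subseteq> w' \<and>
     (\<forall>x n L. (x, n) \<in> p' \<longrightarrow> (x, n) \<notin> p \<longrightarrow> (L, n) \<in> w \<longrightarrow> x \<notin> L)" for p' w' p w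
    by (auto simp: r_def)
  \<comment> \<open>Meeting \<open>D1 x\<close> puts \<open>x\<close> into the domain of
    \<open>g\<close>; meeting \<open>D2 L n\<close> secures the promise that keeps the points of
    \<open>L\<close> with value \<open>n\<close> finite in number.\<close>
  define D1 where "D1 x = {(p, w). (p, w) \<in> A \<and> x \<in> Domain p}" for x
  define D2 where "D2 L n = {(p, w). (p, w) \<in> A \<and> (L, n) \<in> w}" for L n
  define \<D> where "\<D> = range D1 \<union> (\<lambda>(L, n). D2 L n) ` (\<L> \<times> UNIV)"
  have "({}, {}) \<in> A" by (simp add: A_def)
  then have ne: "A \<noteq> {}" by blast
  have po: "partial_order_on A r"
    unfolding partial_order_on_def preorder_on_def
  proof (intro conjI)
    show "r \<subseteq> A \<times> A" by (auto simp: r_def)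
    show "refl_on A r" by (auto simp: r_def refl_on_def)
    show "antisym r" by (rule antisymI) (auto simp: r_def)
    show "trans r"
    proof (rule transI)
      fix a b c assume ab: "(a, b) \<in> r" and bc: "(b, c) \<in> r"
      obtain p w p' w' p'' w'' where eq: "a = (p, w)" "b = (p', w')" "c = (p'', w'')"
        by (metis surj_pair)
      have "x \<notin> L" if "(x, n) \<in> p" "(x, n) \<notin> p''" "(L, n) \<in> w''" for x n L
        using ab bc that unfolding eq r_iff by (cases "(x, n) \<in> p'") blast+
      moreover have "(p, w) \<in> A" "p' \<subseteq> p" "w' \<subseteq> w" "(p'', w'') \<in> A" "p'' \<subseteq> p'" "w'' \<subseteq> w'"
        using ab bc unfolding eq r_iff by simp_all
      moreover from this have "p'' \<subseteq> p" "w'' \<subseteq> w" by simp_all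
      ultimately show "(a, c) \<in> r" unfolding eq r_iff by simp
    qed
  qed
  \<comment> \<open>An uncountable antichain is thinned out until the domains form a delta system
    and the conditions agree on the root. Then \<open>disjoint_from_ladders\<close> gives two
    conditions whose points outside the root avoid each other's promised ladders, and their union
    extends both.\<close>
  have ccc: "ccc A r"
    unfolding ccc_def
  proof (intro allI impI, rule ccontr)
    fix C assume C: "antichain_in A r C" and "uncountable C"
    have CA: "fst c \<in> {p. finite p \<and> single_valued p}" "finite (snd c)" "fst ` snd c \<subseteq> \<L>" "c \<in> A"
      if "c \<in> C" for c
    proof -
      show "c \<in> A" using that C unfolding antichain_in_def by blast
      then show "fst c \<in> {p. finite p \<and> single_valued p}" "finite (snd c)" "fst ` snd c \<subseteq> \<L>"
        by (simp_all add: A_def split_beta)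
    qed
    have "finite (Domain (fst c))" if "c \<in> C" for c using CA(1)[OF that] by (simp add: finite_Domain)
    with \<open>uncountable C\<close> obtain J R where J: "J \<subseteq> C" "uncountable J" "finite R"
        and disj: "disjoint_family_on (\<lambda>c. Domain (fst c) - R) J"
      using delta_system[of C "\<lambda>c. Domain (fst c)"] by metis
    have "countable {q. finite q \<and> q \<subseteq> R \<times> (UNIV :: nat set)}"
      using J(3) by (intro countable_Collect_finite_subset) (simp add: countable_finite)
    moreover have "(\<lambda>c. fst c \<inter> R \<times> UNIV) ` J \<subseteq> {q. finite q \<and> q \<subseteq> R \<times> (UNIV :: nat set)}"
      using CA(1) J(1) by auto
    ultimately obtain q where q: "uncountable {c\<in>J. fst c \<inter> R \<times> UNIV = q}"
      by (rule uncountable_fibre[OF J(2)])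
    define K where "K = {c\<in>J. fst c \<inter> R \<times> UNIV = q}"
    have K: "uncountable K" "K \<subseteq> J" using q by (auto simp: K_def)
    have disjK: "disjoint_family_on (\<lambda>c. Domain (fst c) - R) K"
      using K(2) disj by (rule disjoint_family_on_mono)
    have KC: "c \<in> C" if "c \<in> K" for c using that K(2) J(1) by blast
    obtain c d where cd: "c \<in> K" "d \<in> K" "c \<noteq> d"
      "(Domain (fst c) - R) \<inter> \<Union>(fst ` snd d) = {}" "(Domain (fst d) - R) \<inter> \<Union>(fst ` snd c) = {}"
    proof (rule disjoint_from_ladders[OF K(1) _ disjK, of "\<lambda>c. fst ` snd c"])
      show "finite (Domain (fst i) - R)" if "i \<in> K" for i
        using CA(1)[OF KC[OF that]] by (simp add: finite_Domain)
      show "finite (fst ` snd i)" if "i \<in> K" for i using CA(2)[OF KC[OF that]] by simp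
      show "ladder L" if "i \<in> K" "L \<in> fst ` snd i" for i L
        using CA(3)[OF KC[OF that(1)]] that(2) lad by blast
    qed
    have same: "(x, n) \<in> fst b" if "(x, n) \<in> fst a" "x \<in> R" "a \<in> K" "b \<in> K" for a b x n
      using that unfolding K_def by blast
    have meet: "x \<in> R" if "x \<in> Domain (fst c)" "x \<in> Domain (fst d)" for x
      using disjK cd(1-3) that unfolding disjoint_family_on_def by blast
    have fin: "finite (fst c \<union> fst d)" "finite (snd c \<union> snd d)" "fst ` (snd c \<union> snd d) \<subseteq> \<L>"
      using CA(1-3)[OF KC[OF cd(1)]] CA(1-3)[OF KC[OF cd(2)]] by auto
    have svc: "single_valued (fst c)" and svd: "single_valued (fst d)"
      using CA(1)[OF KC[OF cd(1)]] CA(1)[OF KC[OF cd(2)]] by auto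
    have "single_valued (fst c \<union> fst d)"
    proof (rule single_valuedI)
      fix x m n assume xm: "(x, m) \<in> fst c \<union> fst d" and xn: "(x, n) \<in> fst c \<union> fst d"
      show "m = n"
      proof (cases "x \<in> R")
        case True
        then have "(x, m) \<in> fst c" "(x, n) \<in> fst c"
          using xm xn same[OF _ True cd(2,1)] by auto
        then show ?thesis using svc by (rule single_valuedD[rotated 1])
      next
        case False
        then have "(x, m) \<in> fst c \<and> (x, n) \<in> fst c \<or> (x, m) \<in> fst d \<and> (x, n) \<in> fst d"
          using xm xn meet by blast
        then show ?thesis using svc svd by (auto dest: single_valuedD)
      qed
    qed
    then have inA: "(fst c \<union> fst d, snd c \<union> snd d) \<in> A"
      using fin by (simp add: A_def)
    have new_c: "x \<notin> L" if xn: "(x, n) \<in> fst d - fst c" and L: "(L, n) \<in> snd c" for x n L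
    proof -
      have "x \<notin> R" using same[OF _ _ cd(2,1)] xn by blast
      then have "x \<in> Domain (fst d) - R" using xn by blast
      moreover have "L \<in> fst ` snd c" using L by force
      ultimately show ?thesis using cd(5) by blast
    qed
    have new_d: "x \<notin> L" if xn: "(x, n) \<in> fst c - fst d" and L: "(L, n) \<in> snd d" for x n L
    proof -
      have "x \<notin> R" using same[OF _ _ cd(1,2)] xn by blast
      then have "x \<in> Domain (fst c) - R" using xn by blast
      moreover have "L \<in> fst ` snd d" using L by force
      ultimately show ?thesis using cd(4) by blast
    qed
    obtain p w p' w' where eq: "c = (p, w)" "d = (p', w')" by (metis surj_pair)
    have "((fst c \<union> fst d, snd c \<union> snd d), c) \<in> r" "((fst c \<union> fst d, snd c \<union> snd d), d) \<in> r"
      using inA new_c new_d CA(4)[OF KC[OF cd(1)]] CA(4)[OF KC[OF cd(2)]]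
      unfolding eq r_iff by simp_all
    then have "compatible_in A r c d" using inA unfolding compatible_in_def by blast
    then show False using C KC cd(1-3) unfolding antichain_in_def by blast
  qed
  have inf: "infinite (UNIV :: om1 set)" by (rule infinite_om1)
  have cD: "|\<D>| \<le>o |UNIV :: om1 set|"
  proof -
    have "|UNIV :: nat set| \<le>o |UNIV :: om1 set|" using inf by (simp add: infinite_iff_card_of_nat)
    then have "|\<L> \<times> (UNIV :: nat set)| \<le>o |UNIV :: om1 set|"
      using card inf by (intro card_of_Times_ordLeq_infinite_Field card_of_Card_order)
        (auto simp: Field_card_of)
    then have "|(\<lambda>(L, n). D2 L n) ` (\<L> \<times> UNIV)| \<le>o |UNIV :: om1 set|"
      using card_of_image ordLeq_transitive by blast
    then show ?thesis unfolding \<D>_def using inf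
      by (intro card_of_Un_ordLeq_infinite_Field card_of_Card_order card_of_image)
        (auto simp: Field_card_of)
  qed
  then have cD: "|\<D>| \<le>o omega1" using card_of_om1 by (rule ordLeq_ordIso_trans)
  have dense: "dense_in_order A r D" if "D \<in> \<D>" for D
  proof -
    from that consider x where "D = D1 x" | L n where "L \<in> \<L>" "D = D2 L n"
      by (auto simp: \<D>_def)
    then show ?thesis
    proof cases
      case 1
      have "\<exists>d\<in>D1 x. (d, c) \<in> r" if "c \<in> A" for c
      proof -
        obtain p w where c: "c = (p, w)" by (metis surj_pair)
        show ?thesis
        proof (cases "x \<in> Domain p")
          case True
          then have "c \<in> D1 x" "(c, c) \<in> r" using that by (simp_all add: D1_def r_iff c)
          then show ?thesis by blast
        next
          case False
          have "finite (snd ` w)" using that by (simp add: A_def c)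
          \<comment> \<open>A value named in no promise, so that the new pair violates none.\<close>
          then obtain n where n: "n \<notin> snd ` w" using ex_new_if_finite[OF infinite_UNIV_nat] by blast
          have "(insert (x, n) p, w) \<in> A"
            using that False by (auto simp: A_def c single_valued_def)
          moreover from this have "((insert (x, n) p, w), c) \<in> r"
            using that n by (force simp: r_iff c)
          ultimately show ?thesis by (auto simp: D1_def)
        qed
      qed
      then show ?thesis using 1 by (auto simp: dense_in_order_def D1_def)
    next
      case 2
      have "\<exists>d\<in>D2 L n. (d, c) \<in> r" if "c \<in> A" for c
      proof -
        obtain p w where c: "c = (p, w)" by (metis surj_pair)
        \<comment> \<open>A new promise restricts later points only, so it can always be
          added.\<close>
        have "(p, insert (L, n) w) \<in> A" using that 2 by (auto simp: A_def c)
        moreover from this have "((p, insert (L, n) w), c) \<in> r" using that by (auto simp: r_iff c)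
        ultimately show ?thesis by (auto simp: D2_def)
      qed
      then show ?thesis using 2 by (auto simp: dense_in_order_def D2_def)
    qed
  qed
  obtain G where G: "filter_in_order A r G" and GD: "\<And>D. D \<in> \<D> \<Longrightarrow> G \<inter> D \<noteq> {}"
    using MA_omega1_transfer[OF MA, where 'a = "(om1 \<times> nat) set \<times> (om1 set \<times> nat) set"]
      ne po ccc cD dense unfolding MA_omega1_def by metis
  define g where "g x = (SOME n. \<exists>(p, w)\<in>G. (x, n) \<in> p)" for x
  have g: "\<exists>p w. (p, w) \<in> G \<and> (x, g x) \<in> p" for x
  proof -
    have "G \<inter> D1 x \<noteq> {}" by (rule GD) (simp add: \<D>_def)
    then have "\<exists>n. \<exists>(p, w)\<in>G. (x, n) \<in> p" by (auto simp: D1_def)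
    then have "\<exists>(p, w)\<in>G. (x, g x) \<in> p" unfolding g_def by (rule someI_ex)
    then show ?thesis by blast
  qed
  have "finite {x\<in>L. g x = n}" if L: "L \<in> \<L>" for L n
  proof -
    have "G \<inter> D2 L n \<noteq> {}" by (rule GD) (use L in \<open>auto simp: \<D>_def\<close>)
    then obtain p w where pw: "(p, w) \<in> G" "(p, w) \<in> A" "(L, n) \<in> w" by (auto simp: D2_def)
    \<comment> \<open>A condition giving \<open>x\<close> the value \<open>n\<close> has a common
      extension with \<open>(p, w)\<close>. The promise \<open>(L, n)\<close> admits no new such
      point there, so the pair was already in \<open>p\<close>.\<close>
    have "x \<in> Domain p" if x: "x \<in> L" "g x = n" for x
    proof -
      obtain p1 w1 where p1: "(p1, w1) \<in> G" "(x, n) \<in> p1" using g[of x] x by blast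
      obtain s v where s: "((s, v), (p, w)) \<in> r" "((s, v), (p1, w1)) \<in> r"
        using G pw(1) p1(1) unfolding filter_in_order_def by (metis surj_pair)
      have "p1 \<subseteq> s" using s(2) unfolding r_iff by simp
      then have "(x, n) \<in> s" using p1(2) by (rule subsetD)
      moreover have "\<forall>x n L. (x, n) \<in> s \<longrightarrow> (x, n) \<notin> p \<longrightarrow> (L, n) \<in> w \<longrightarrow> x \<notin> L"
        using s(1) unfolding r_iff by simp
      ultimately have "(x, n) \<in> p" using pw(3) x(1) by blast
      then show ?thesis by (rule DomainI)
    qed
    then have "{x\<in>L. g x = n} \<subseteq> Domain p" by blast
    moreover have "finite (Domain p)" using pw(2) by (simp add: A_def finite_Domain)
    ultimately show ?thesis by (rule finite_subset)
  qed
  then show ?thesis by blast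
qed

section \<open>Finite-to-one functions on bounded parts of \<open>\<omega>\<^sub>2\<close>\<close>

lemma finite_to_one_le:
  fixes f :: "'a \<Rightarrow> nat"
  assumes "\<And>n. finite {x. P x \<and> f x = n}"
  shows "finite {x. P x \<and> f x \<le> n}"
proof -
  have "{x. P x \<and> f x \<le> n} = (\<Union>k\<le>n. {x. P x \<and> f x = k})" by auto
  then show ?thesis using assms by simp
qed

lemma finite_to_one_on_initial_segments:
  fixes S :: "om2 set set"
  assumes MA: "MA_omega1 TYPE(nat set set)"
    and lad: "\<And>s. s \<in> S \<Longrightarrow> ladder s"
    and few: "\<And>a. |{s\<in>S. s \<subseteq> {..<a}}| \<le>o |UNIV :: om1 set|"
  shows "\<exists>f :: om2 \<Rightarrow> nat. \<forall>s\<in>S. \<forall>n. finite {x\<in>s. x \<le> a \<and> f x = n}"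
proof (induction a rule: less_induct)
  case (less a)
  then obtain F :: "om2 \<Rightarrow> om2 \<Rightarrow> nat"
    where F: "\<And>b s n. b < a \<Longrightarrow> s \<in> S \<Longrightarrow> finite {x\<in>s. x \<le> b \<and> F b x = n}" by metis
  have "\<exists>f :: om2 \<Rightarrow> nat. \<forall>s\<in>S. \<forall>n. finite {x\<in>s. x < a \<and> f x = n}"
  proof (cases "\<exists>b. b < a")
    case False
    then show ?thesis by simp
  next
    case True
    then obtain b0 where b0: "b0 < a" ..
    obtain e' :: "om1 \<Rightarrow> om2" where e': "range e' = {..a}" by (rule initial_om2_surj)
    \<comment> \<open>\<open>b0\<close> replaces the only value of \<open>e'\<close> that is not
      below \<open>a\<close>, namely \<open>a\<close> itself.\<close>
    define e where "e i = (if e' i < a then e' i else b0)" for i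
    have e_less: "e i < a" for i using b0 by (simp add: e_def)
    have e_surj: "\<exists>i. x = e i" if "x < a" for x
    proof -
      have "x \<in> range e'" using e' that by simp
      then obtain i where "x = e' i" ..
      then show ?thesis using that by (intro exI[of _ i]) (simp add: e_def)
    qed
    txt \<open>\<open>h\<close> is monotone into \<open>\<omega>\<^sub>1\<close> with fibres bounded below \<open>a\<close>. It maps ladders to ladders, so
      Martin's axiom leaves only finitely many fibres with values at most \<open>n\<close>, and inside a fibre the
      induction hypothesis applies; no case distinction on the cofinality of \<open>a\<close> is needed.\<close>
    define h where "h x = (LEAST i. x \<le> e i)" for x
    have h: "x \<le> e (h x)" if x: "x < a" for x
    proof -
      obtain i where "x = e i" using e_surj[OF x] ..
      then have "x \<le> e i" by simp
      then show ?thesis unfolding h_def by (rule LeastI)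
    qed
    have h_mono: "h x \<le> h y" if "x \<le> y" "y < a" for x y
      unfolding h_def[of x] by (rule Least_le) (rule order_trans[OF that(1) h[OF that(2)]])
    define \<L> where "\<L> = (\<lambda>s. h ` s) ` {s\<in>S. s \<subseteq> {..<a}}"
    have "\<exists>g :: om1 \<Rightarrow> nat. \<forall>L\<in>\<L>. \<forall>n. finite {x\<in>L. g x = n}"
    proof (rule finite_to_one_on_ladders[OF MA])
      show "|\<L>| \<le>o |UNIV :: om1 set|"
        unfolding \<L>_def using card_of_image few by (rule ordLeq_transitive)
      fix L assume "L \<in> \<L>"
      then obtain s where s: "s \<in> S" "s \<subseteq> {..<a}" "L = h ` s" by (auto simp: \<L>_def)
      show "ladder L" unfolding ladder_def
      proof
        fix y assume "y \<in> L"
        then obtain x where x: "x \<in> s" "y = h x" using s by blast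
        have "L \<inter> {..<y} \<subseteq> h ` (s \<inter> {..<x})"
        proof
          fix w assume "w \<in> L \<inter> {..<y}"
          then obtain z where z: "z \<in> s" "w = h z" "h z < h x" using s x by auto
          have "z < a" using z(1) s(2) by blast
          have "z < x"
          proof (rule ccontr)
            assume "\<not> z < x"
            then have "h x \<le> h z" using \<open>z < a\<close> by (intro h_mono) simp_all
            with z(3) show False by simp
          qed
          then show "w \<in> h ` (s \<inter> {..<x})" using z by blast
        qed
        moreover have "finite (h ` (s \<inter> {..<x}))" using lad[OF s(1)] x by (simp add: ladder_def)
        ultimately show "finite (L \<inter> {..<y})" by (rule finite_subset)
      qed
    qed
    then obtain g :: "om1 \<Rightarrow> nat" where g: "\<And>L n. L \<in> \<L> \<Longrightarrow> finite {x. x \<in> L \<and> g x = n}" by blast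
    \<comment> \<open>With the maximum, a bound on \<open>f x\<close> bounds both terms:
      \<open>g\<close> leaves finitely many fibres of \<open>h\<close> on the ladder, and
      \<open>F\<close> finitely many points in each.\<close>
    define f where "f x = max (F (e (h x)) x) (g (h x))" for x
    have "finite {x\<in>s. x < a \<and> f x = n}" if s: "s \<in> S" for s n
    proof (cases "finite (s \<inter> {..<a})")
      case True
      then show ?thesis by (rule rev_finite_subset) auto
    next
      case False
      \<comment> \<open>A point of \<open>s\<close> at or above \<open>a\<close> would have
        infinitely many predecessors in \<open>s\<close>. Hence only the ladders counted by
        \<open>few\<close> matter.\<close>
      have "s \<subseteq> {..<a}"
      proof (rule ccontr)
        assume "\<not> s \<subseteq> {..<a}"
        then obtain x where "x \<in> s" "x \<notin> {..<a}" by blast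
        then have x: "x \<in> s" "a \<le> x" by simp_all
        then have "finite (s \<inter> {..<x})" using lad[OF s] by (simp add: ladder_def)
        then have "finite (s \<inter> {..<a})" by (rule rev_finite_subset) (use x in auto)
        with False show False by blast
      qed
      then have "h ` s \<in> \<L>" using s by (auto simp: \<L>_def)
      then have E: "finite {i. i \<in> h ` s \<and> g i \<le> n}" by (intro finite_to_one_le g)
      have "finite {x. (x \<in> s \<and> x \<le> e i) \<and> F (e i) x \<le> n}" for i
        using F[OF e_less s] by (intro finite_to_one_le) (simp add: conj_assoc)
      then have "finite (\<Union>i\<in>{i. i \<in> h ` s \<and> g i \<le> n}. {x. (x \<in> s \<and> x \<le> e i) \<and> F (e i) x \<le> n})"
        using E by blast
      then show ?thesis
      proof (rule rev_finite_subset, intro subsetI)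
        fix x assume x: "x \<in> {x\<in>s. x < a \<and> f x = n}"
        then show "x \<in> (\<Union>i\<in>{i. i \<in> h ` s \<and> g i \<le> n}. {x. (x \<in> s \<and> x \<le> e i) \<and> F (e i) x \<le> n})"
          using h[of x] by (intro UN_I[of "h x"]) (auto simp: f_def)
      qed
    qed
    then show ?thesis by blast
  qed
  then obtain f :: "om2 \<Rightarrow> nat" where f: "\<And>s n. s \<in> S \<Longrightarrow> finite {x\<in>s. x < a \<and> f x = n}" by blast
  have "finite {x\<in>s. x \<le> a \<and> f x = n}" if "s \<in> S" for s n
  proof (rule finite_subset)
    show "{x\<in>s. x \<le> a \<and> f x = n} \<subseteq> insert a {x\<in>s. x < a \<and> f x = n}" by auto
    show "finite (insert a {x\<in>s. x < a \<and> f x = n})" using f[OF that] by simp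
  qed
  then show ?case by blast
qed

section \<open>A family of ladders without a global finite-to-one function\<close>

text \<open>A pairing injection turns the graph of a function into a subset of
  \<open>Field omega1\<close>, and by hypothesis there are \<open>omega2\<close> many of
  these.\<close>

lemma card_of_functions_le_om2:
  assumes "ctwo ^c omega1 =o omega2"
  obtains code :: "(om1 \<Rightarrow> om1 \<Rightarrow> nat) \<Rightarrow> om2" where "inj code"
proof -
  have inf: "infinite (UNIV :: om1 set)" by (rule infinite_om1)
  have "|UNIV :: nat set| \<le>o |UNIV :: om1 set|" using inf by (simp add: infinite_iff_card_of_nat)
  then have "|(UNIV :: om1 set) \<times> (UNIV :: om1 set) \<times> (UNIV :: nat set)| \<le>o |UNIV :: om1 set|"
    using inf
    by (intro card_of_Times_ordLeq_infinite_Field card_of_Card_order ordLeq_refl card_of_Well_order)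
      (simp_all add: Field_card_of)
  then obtain p :: "om1 \<times> om1 \<times> nat \<Rightarrow> om1" where p: "inj p"
    by (auto simp flip: card_of_ordLeq)
  define gr where "gr f = Rep_om1 ` p ` {(x, y, n). f x y = n}" for f :: "om1 \<Rightarrow> om1 \<Rightarrow> nat"
  have "inj gr"
  proof (rule injI)
    fix f f' assume "gr f = gr f'"
    then have "{(x, y, n). f x y = n} = {(x, y, n). f' x y = n}"
      unfolding gr_def by (simp add: inj_image_eq_iff om1_iso(1) p)
    then have "\<forall>x y n. f x y = n \<longleftrightarrow> f' x y = n" by (auto simp: set_eq_iff)
    then show "f = f'" by blast
  qed
  moreover have "range gr \<subseteq> Pow (Field omega1)" using om1_iso(2) by (auto simp: gr_def)
  ultimately have "|UNIV :: (om1 \<Rightarrow> om1 \<Rightarrow> nat) set| \<le>o |Pow (Field omega1)|"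
    unfolding card_of_ordLeq[symmetric] by blast
  also have "|Pow (Field omega1)| =o |Func (Field omega1) (UNIV :: bool set)|"
    by (rule card_of_Pow_Func)
  also have "|Func (Field omega1) (UNIV :: bool set)| = ctwo ^c omega1"
    by (simp add: cexp_def ctwo_def Field_card_of)
  also have "ctwo ^c omega1 =o omega2" by (rule assms)
  also have "omega2 =o |UNIV :: om2 set|" by (rule ordIso_symmetric[OF card_of_om2])
  finally show ?thesis using that by (auto simp flip: card_of_ordLeq)
qed

lemma card_of_countable_om1:
  assumes "countable A"
  shows "|A| \<le>o |UNIV :: om1 set|"
proof -
  have "|A| \<le>o |UNIV :: nat set|" using assms by (auto simp: countable_def simp flip: card_of_ordLeq)
  also have "|UNIV :: nat set| \<le>o |UNIV :: om1 set|"
    using infinite_om1 by (simp add: infinite_iff_card_of_nat)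
  finally show ?thesis .
qed

text \<open>If all fibres were bounded, their countably many bounds would lie below a single
  \<open>b\<close>, which could then have no colour.\<close>

lemma unbounded_fibre:
  fixes c :: "om2 \<Rightarrow> nat"
  shows "\<exists>k. \<forall>y. \<exists>x\<ge>y. c x = k"
proof (rule ccontr)
  assume "\<not> ?thesis"
  then obtain Y where Y: "\<And>k x. Y k \<le> x \<Longrightarrow> c x \<noteq> k" by metis
  obtain b where "\<forall>a\<in>range Y. a < b"
    using bounded_om2[OF card_of_countable_om1[of "range Y"]] by auto
  then have "Y (c b) \<le> b" by (simp add: order_less_imp_le)
  with Y show False by blast
qed

lemma ladder_family_exists:
  assumes "ctwo ^c omega1 =o omega2"
  shows "\<exists>S :: om2 set set. (\<forall>s\<in>S. ladder s) \<and>
    (\<forall>a. |{s\<in>S. s \<subseteq> {..<a}}| \<le>o |UNIV :: om1 set| ) \<and>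
    (\<forall>r :: om2 \<Rightarrow> nat. \<exists>s\<in>S. \<exists>n. infinite {x\<in>s. r x = n})"
proof -
  obtain code :: "(om1 \<Rightarrow> om1 \<Rightarrow> nat) \<Rightarrow> om2" where "inj code"
    by (rule card_of_functions_le_om2[OF assms])
  define dec where "dec = inv code"
  have dec_code: "dec (code f) = f" for f using \<open>inj code\<close> by (simp add: dec_def)
  have "\<forall>d. \<exists>e :: om1 \<Rightarrow> om2. range e = {..d}" using initial_om2_surj by metis
  \<comment> \<open>Composition with \<open>e y\<close> turns functions on \<open>{..y}\<close> into
    functions on \<open>om1\<close>, to which \<open>code\<close> applies.\<close>
  then obtain e :: "om2 \<Rightarrow> om1 \<Rightarrow> om2" where e: "\<And>d. range (e d) = {..d}" by metis
  txt \<open>As in Shelah's proof of the diamond principle from \<open>2\<^bsup>\<kappa>\<^esup> = \<kappa>\<^sup>+\<close>: a pair \<open>(y, i)\<close> is the guess that the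
    ordinal \<open>i\<close> codes the restriction to \<open>{..y}\<close> of a sequence of \<open>\<omega>\<^sub>1\<close> many functions. \<open>V c t d j\<close> is
    the countable set of guesses below \<open>d\<close>, bounded by \<open>j\<close>, that are right about the first \<open>t\<close> entries
    of \<open>c\<close>. The ladders of \<open>S c t\<close> are chosen to be monochromatic for the entry \<open>t\<close> as it is guessed.\<close>
  define V where "V c t d j = {(y, i). y \<in> e d ` {..<j} \<and> i \<in> e d ` {..<j} \<and>
      (\<forall>u<t. \<forall>z. dec i u z = c u (e y z))}" for c :: "om1 \<Rightarrow> om2 \<Rightarrow> nat" and t d j
  define Q where "Q c t d j s k \<longleftrightarrow> ladder s \<and> infinite s \<and> s \<subseteq> {..<d} \<and> (\<forall>y<d. \<exists>x\<in>s. y \<le> x) \<and>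
      (\<forall>x\<in>s. \<exists>y i z. (y, i) \<in> V c t d j \<and> x = e y z \<and> dec i t z = k)" for c t d j s k
  \<comment> \<open>The choice sees \<open>c\<close> only through \<open>V\<close>, hence only its
    entries below \<open>t\<close>. This permits the well-founded recursion that produces
    \<open>c\<close>.\<close>
  define pick where "pick c t d j = (SOME s. \<exists>k. Q c t d j s k)" for c t d j
  define S where "S c t = {pick c t d j | d j. \<exists>s k. Q c t d j s k}" for c t
  have pick: "\<exists>k. Q c t d j (pick c t d j) k" if "\<exists>s k. Q c t d j s k" for c t d j
    unfolding pick_def using that by (rule someI_ex)
  have "\<exists>c t. \<forall>r :: om2 \<Rightarrow> nat. \<exists>s\<in>S c t. \<exists>n. infinite {x\<in>s. r x = n}"
  proof (rule ccontr)
    define P where "P c t r \<longleftrightarrow> (\<forall>s\<in>S c t. \<forall>n. finite {x\<in>s. r x = n})"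
      for c t and r :: "om2 \<Rightarrow> nat"
    assume "\<not> ?thesis"
    then have ex: "\<exists>r. P c t r" for c t unfolding P_def by blast
    txt \<open>If every attempt fails, collect counterexamples \<open>c t\<close> along \<open>\<omega>\<^sub>1\<close>.\<close>
    have "\<exists>c. \<forall>t. P c t (c t)"
    proof (rule dependent_wf_choice[of "{(x, y). x < y}"])
      show "wf {(x :: om1, y). x < y}" by (rule wf)
      show "\<exists>r. P f x r" for f x by (rule ex)
      fix f g :: "om1 \<Rightarrow> om2 \<Rightarrow> nat" and x r
      assume fg: "\<And>z. (z, x) \<in> {(x, y). x < y} \<Longrightarrow> f z = g z"
      have "V f x = V g x" by (intro ext) (simp add: V_def fg cong: conj_cong)
      then have "Q f x = Q g x" by (intro ext) (simp add: Q_def)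
      then have "S f x = S g x" by (simp add: S_def pick_def)
      then show "P f x r = P g x r" by (simp add: P_def)
    qed
    then obtain c where c: "\<And>t. P c t (c t)" by blast
    \<comment> \<open>\<open>kk t\<close> is a value that \<open>c t\<close> takes unboundedly
      often.\<close>
    obtain kk nxt where nxt: "\<And>t y. y \<le> nxt t y \<and> c t (nxt t y) = kk t"
      using unbounded_fibre[of "c _"] by metis
    \<comment> \<open>The correct guess for \<open>{..y}\<close>.\<close>
    define phi where "phi y = code (\<lambda>t z. c t (e y z))" for y
    have dec_phi: "dec (phi y) t z = c t (e y z)" for y t z by (simp add: phi_def dec_code)
    have "\<exists>y'. y < y' \<and> phi y < y' \<and> (\<forall>t. nxt t y < y')" for y
      using bounded_om2_range[of "\<lambda>t. max (nxt t y) (max y (phi y))"] by auto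
    then obtain st where st: "\<And>y. y < st y \<and> phi y < st y \<and> (\<forall>t. nxt t y < st y)" by metis
    \<comment> \<open>Each term exceeds \<open>phi\<close> and all \<open>nxt t\<close> of its
      predecessor; the start is arbitrary.\<close>
    define u where "u n = (st ^^ n) undefined" for n
    have u: "u n < u (Suc n)" "phi (u n) < u (Suc n)" "nxt t (u n) < u (Suc n)" for n t
      using st[of "u n"] by (simp_all add: u_def)
    obtain b where b: "\<forall>n. u n < b"
      using bounded_om2[OF card_of_countable_om1[of "range u"]] by auto
    define d where "d = (LEAST b. \<forall>n. u n < b)"
    have ud: "u n < d" for n
      using LeastI[of "\<lambda>b. \<forall>n. u n < b" b] b by (simp add: d_def)
    have d_least: "\<exists>n. y \<le> u n" if "y < d" for y
      using not_less_Least[of y "\<lambda>b. \<forall>n. u n < b"] that by (auto simp: d_def not_less)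
    have pd: "phi (u n) < d" for n using u(2)[of n] ud[of "Suc n"] by order
    have "\<exists>z. u n = e d z" "\<exists>z. phi (u n) = e d z" for n
      using e[of d] ud[of n] pd[of n] by (metis atMost_iff imageE order_less_imp_le)+
    then obtain z1 z2 where z: "\<And>n. u n = e d (z1 n)" "\<And>n. phi (u n) = e d (z2 n)" by metis
    \<comment> \<open>One \<open>j\<close> bounds countably many indices, so the correct guesses
      \<open>(u n, phi (u n))\<close> lie in \<open>V c t d j\<close> for every
      \<open>t\<close>.\<close>
    obtain j where "\<forall>a\<in>range z1 \<union> range z2. a < j"
      using bounded_om1[of "range z1 \<union> range z2"] by auto
    then have j: "z1 n < j" "z2 n < j" for n by auto
    have inV: "(u n, phi (u n)) \<in> V c t d j" for n t
    proof -
      have "u n \<in> e d ` {..<j}" "phi (u n) \<in> e d ` {..<j}" using z j by auto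
      then show ?thesis by (simp add: V_def dec_phi)
    qed
    txt \<open>The countable sets \<open>V c t d j\<close> decrease with \<open>t\<close>, so they cannot shrink at every \<open>t < \<omega>\<^sub>1\<close>.\<close>
    have "\<exists>t. \<forall>(y, i)\<in>V c t d j. \<forall>z. dec i t z = c t (e y z)"
    proof (rule ccontr)
      assume "\<not> ?thesis"
      then have "\<forall>t. \<exists>v. v \<in> V c t d j \<and> \<not> (\<forall>z. dec (snd v) t z = c t (e (fst v) z))" by fastforce
      then obtain v where v: "\<And>t. v t \<in> V c t d j"
        "\<And>t. \<not> (\<forall>z. dec (snd (v t)) t z = c t (e (fst (v t)) z))" by metis
      have "inj v"
      proof (rule linorder_inj_onI')
        fix t t' :: om1 assume "t < t'"
        then have "\<forall>z. dec (snd (v t')) t z = c t (e (fst (v t')) z)"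
          using v(1)[of t'] by (auto simp: V_def)
        then show "v t \<noteq> v t'" using v(2)[of t] by metis
      qed
      have "v t \<in> e d ` {..<j} \<times> e d ` {..<j}" for t
        using v(1)[of t] by (cases "v t") (simp add: V_def)
      then have "range v \<subseteq> e d ` {..<j} \<times> e d ` {..<j}" by blast
      moreover have "countable (e d ` {..<j} \<times> e d ` {..<j})"
        using countable_initial_om1 by simp
      ultimately have "countable (range v)" by (rule countable_subset)
      then have "countable (UNIV :: om1 set)" using \<open>inj v\<close> by (rule countable_image_inj_on)
      then show False using uncountable_om1 by blast
    qed
    then obtain t where t: "\<And>y i z. (y, i) \<in> V c t d j \<Longrightarrow> dec i t z = c t (e y z)" by blast
    \<comment> \<open>The points \<open>x n\<close> interleave with \<open>u\<close>: they form a
      ladder cofinal in \<open>d\<close> on which \<open>c t\<close> is constant, so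
      \<open>pick\<close> has a candidate.\<close>
    define x where "x n = nxt t (u n)" for n
    have x: "u n \<le> x n" "x n < u (Suc n)" "c t (x n) = kk t" for n
      using nxt u(3) by (simp_all add: x_def)
    have "x n < x (Suc n)" for n using x(2)[of n] x(1)[of "Suc n"] by order
    then have "strict_mono x" by (simp add: strict_mono_Suc_iff)
    have "Q c t d j (range x) (kk t)" unfolding Q_def
    proof (intro conjI)
      show "ladder (range x)" unfolding ladder_def
      proof
        fix y assume "y \<in> range x"
        then obtain n where "y = x n" by blast
        then have "range x \<inter> {..<y} \<subseteq> x ` {..<n}"
          using \<open>strict_mono x\<close> by (auto simp: strict_mono_less)
        then show "finite (range x \<inter> {..<y})" by (rule finite_subset) simp
      qed
      show "infinite (range x)"
        using \<open>strict_mono x\<close> by (intro range_inj_infinite strict_mono_imp_inj_on)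
      show "range x \<subseteq> {..<d}" using x(2) ud by (auto intro: less_trans)
      show "\<forall>y<d. \<exists>x'\<in>range x. y \<le> x'" using d_least x(1) by (meson order_trans rangeI)
      show "\<forall>x'\<in>range x. \<exists>y i z. (y, i) \<in> V c t d j \<and> x' = e y z \<and> dec i t z = kk t"
      proof
        fix x' assume "x' \<in> range x"
        then obtain n where n: "x' = x n" by blast
        then have "x' \<in> range (e (u (Suc n)))" using e x(2)[of n] by simp
        then obtain z where "x' = e (u (Suc n)) z" by blast
        then show "\<exists>y i z. (y, i) \<in> V c t d j \<and> x' = e y z \<and> dec i t z = kk t"
          using inV[of "Suc n" t] x(3)[of n] n dec_phi by metis
      qed
    qed
    then have ex_Q: "\<exists>s k. Q c t d j s k" by blast
    then have inS: "pick c t d j \<in> S c t" by (auto simp: S_def)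
    obtain k where k: "Q c t d j (pick c t d j) k" using pick[OF ex_Q] ..
    \<comment> \<open>The picked ladder may differ from \<open>range x\<close>, but its points are
      labelled by guesses in \<open>V\<close>, which are right about entry \<open>t\<close>.\<close>
    have "c t y = k" if "y \<in> pick c t d j" for y
      using k that t unfolding Q_def by metis
    then have "{y\<in>pick c t d j. c t y = k} = pick c t d j" by blast
    moreover have "finite {y\<in>pick c t d j. c t y = k}" using c[of t] inS by (simp add: P_def)
    ultimately show False using k by (simp add: Q_def)
  qed
  then obtain c t where hit: "\<And>r :: om2 \<Rightarrow> nat. \<exists>s\<in>S c t. \<exists>n. infinite {x\<in>s. r x = n}" by blast
  have lad: "ladder s" if "s \<in> S c t" for s
    using that pick unfolding S_def Q_def by blast
  have few: "|{s\<in>S c t. s \<subseteq> {..<a}}| \<le>o |UNIV :: om1 set|" for a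
  proof -
    have "{s\<in>S c t. s \<subseteq> {..<a}} \<subseteq> (\<lambda>(d, j). pick c t d j) ` ({..a} \<times> UNIV)"
    proof
      fix s assume s: "s \<in> {s\<in>S c t. s \<subseteq> {..<a}}"
      then obtain d j where dj: "s = pick c t d j" "\<exists>s k. Q c t d j s k" by (auto simp: S_def)
      then have cof: "\<forall>y<d. \<exists>x\<in>s. y \<le> x" using pick[of c t d j] unfolding Q_def by blast
      \<comment> \<open>The ladder is cofinal in \<open>d\<close>, so it fits below \<open>a\<close>
        only for such \<open>d\<close>.\<close>
      have "d \<le> a"
      proof (rule ccontr)
        assume "\<not> d \<le> a"
        then have "a < d" by simp
        then obtain x where "x \<in> s" "a \<le> x" using cof by blast
        then show False using s by auto
      qed
      with dj show "s \<in> (\<lambda>(d, j). pick c t d j) ` ({..a} \<times> UNIV)" by auto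
    qed
    then have "|{s\<in>S c t. s \<subseteq> {..<a}}| \<le>o |(\<lambda>(d, j). pick c t d j) ` ({..a} \<times> UNIV)|"
      by (rule card_of_mono1)
    also have "|(\<lambda>(d, j). pick c t d j) ` ({..a} \<times> UNIV)| \<le>o |{..a} \<times> (UNIV :: om1 set)|"
      by (rule card_of_image)
    also have "|{..a} \<times> (UNIV :: om1 set)| \<le>o |UNIV :: om1 set|"
      using infinite_om1 card_initial_om2
      by (intro card_of_Times_ordLeq_infinite_Field card_of_Card_order ordLeq_refl card_of_Well_order)
        (simp_all add: Field_card_of)
    finally show ?thesis .
  qed
  show ?thesis by (intro exI[of _ "S c t"] conjI ballI allI lad few hit)
qed

section \<open>The topology\<close>

definition spoke_topology :: "'a set \<Rightarrow> 'a \<Rightarrow> 'a set set \<Rightarrow> 'a topology" where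
  "spoke_topology Y p T = topology (\<lambda>U. U \<subseteq> Y \<and> (p \<in> U \<longrightarrow> (\<forall>t\<in>T. finite (t - U))))"

lemma openin_spoke_topology:
  "openin (spoke_topology Y p T) U \<longleftrightarrow> U \<subseteq> Y \<and> (p \<in> U \<longrightarrow> (\<forall>t\<in>T. finite (t - U)))"
proof -
  have "istopology (\<lambda>U. U \<subseteq> Y \<and> (p \<in> U \<longrightarrow> (\<forall>t\<in>T. finite (t - U))))"
    unfolding istopology_def
  proof (intro conjI allI impI ballI)
    fix U V t assume "U \<subseteq> Y \<and> (p \<in> U \<longrightarrow> (\<forall>t\<in>T. finite (t - U)))"
      "V \<subseteq> Y \<and> (p \<in> V \<longrightarrow> (\<forall>t\<in>T. finite (t - V)))" "p \<in> U \<inter> V" "t \<in> T"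
    then have "finite ((t - U) \<union> (t - V))" by simp
    then show "finite (t - U \<inter> V)" by (rule rev_finite_subset) blast
  next
    fix \<K> t assume K: "\<forall>U\<in>\<K>. U \<subseteq> Y \<and> (p \<in> U \<longrightarrow> (\<forall>t\<in>T. finite (t - U)))"
      "p \<in> \<Union>\<K>" "t \<in> T"
    then obtain U where "U \<in> \<K>" "finite (t - U)" by blast
    then show "finite (t - \<Union>\<K>)" by (meson Diff_mono Union_upper finite_subset order_refl)
  qed auto
  then show ?thesis by (simp add: spoke_topology_def topology_inverse')
qed

lemma topspace_spoke_topology:
  assumes "\<And>t. t \<in> T \<Longrightarrow> t \<subseteq> Y"
  shows "topspace (spoke_topology Y p T) = Y"
proof
  show "topspace (spoke_topology Y p T) \<subseteq> Y"
    using openin_topspace[of "spoke_topology Y p T"] unfolding openin_spoke_topology by blast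
  have "finite (t - Y)" if "t \<in> T" for t using assms[OF that] by (simp add: Diff_eq_empty_iff[THEN iffD2])
  then have "openin (spoke_topology Y p T) Y" by (simp add: openin_spoke_topology)
  then show "Y \<subseteq> topspace (spoke_topology Y p T)" by (rule openin_subset)
qed

lemma Frechet_spoke_topology:
  assumes TY: "\<And>t. t \<in> T \<Longrightarrow> t \<subseteq> Y"
  shows "Frechet_space (spoke_topology Y p T)"
  unfolding Frechet_space_def
proof (intro ballI allI impI iffI)
  let ?X = "spoke_topology Y p T"
  note top = topspace_spoke_topology[of T Y p, OF TY]
  fix x A assume x: "x \<in> topspace ?X" and A: "A \<subseteq> topspace ?X"
  {
    assume cl: "x \<in> ?X closure_of A"
    have const: "\<exists>s. range s \<subseteq> A \<and> limitin ?X s x sequentially" if "x \<in> A"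
      using that x by (intro exI[of _ "\<lambda>_. x"]) simp
    show "\<exists>s. range s \<subseteq> A \<and> limitin ?X s x sequentially"
    proof (cases "x \<in> A")
      case False
      have "x = p"
      proof (rule ccontr)
        assume "x \<noteq> p"
        then have "openin ?X {x}" using x by (simp add: openin_spoke_topology top)
        then have "\<exists>y\<in>A. y \<in> {x}" using cl unfolding in_closure_of by blast
        with False show False by simp
      qed
      have "\<exists>t\<in>T. infinite (t \<inter> A)"
      proof (rule ccontr)
        assume "\<not> ?thesis"
        moreover have "t - (Y - A) = t \<inter> A" if "t \<in> T" for t using TY[OF that] by blast
        ultimately have "openin ?X (Y - A)" by (simp add: openin_spoke_topology)
        moreover have "x \<in> Y - A" using x False by (simp add: top)
        ultimately have "\<exists>y\<in>A. y \<in> Y - A" using cl unfolding in_closure_of by blast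
        then show False by blast
      qed
      then obtain t where t: "t \<in> T" "infinite (t \<inter> A)" by blast
      \<comment> \<open>By injectivity the sequence visits the finite set \<open>t - U\<close> only
        finitely often, for every neighbourhood \<open>U\<close>.\<close>
      then obtain s :: "nat \<Rightarrow> 'a" where s: "inj s" "range s \<subseteq> t \<inter> A"
        using infinite_countable_subset by blast
      have "limitin ?X s x sequentially" unfolding limitin_def
      proof (intro conjI allI impI)
        show "x \<in> topspace ?X" by (rule x)
        fix U assume "openin ?X U \<and> x \<in> U"
        then have "finite (t - U)" using t(1) by (simp add: openin_spoke_topology \<open>x = p\<close>)
        then have "finite (s -` (t - U))" using s(1) by (intro finite_vimageI)
        then have "finite {n. s n \<notin> U}" by (rule rev_finite_subset) (use s(2) in auto)
        then show "\<forall>\<^sub>F n in sequentially. s n \<in> U"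
          by (simp add: eventually_cofinite flip: cofinite_eq_sequentially)
      qed
      then show ?thesis using s(2) by blast
    qed (rule const)
  }
  {
    assume "\<exists>s :: nat \<Rightarrow> 'a. range s \<subseteq> A \<and> limitin ?X s x sequentially"
    then obtain s :: "nat \<Rightarrow> 'a" where s: "range s \<subseteq> A" "limitin ?X s x sequentially" by blast
    show "x \<in> ?X closure_of A" unfolding in_closure_of
    proof (intro conjI allI impI)
      fix U assume "x \<in> U \<and> openin ?X U"
      then have "\<forall>\<^sub>F n in sequentially. s n \<in> U" using s(2) by (simp add: limitin_def)
      then obtain n where "s n \<in> U" by (auto simp: eventually_sequentially)
      then show "\<exists>y. y \<in> A \<and> y \<in> U" using s(1) by blast
    qed (rule x)
  }
qed

section \<open>Closure of the centre in the G_delta-modification\<close>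

lemma in_closure_of_Gdelta_modification:
  "x \<in> Gdelta_modification X closure_of A \<longleftrightarrow>
     x \<in> topspace X \<and> (\<forall>G. gdelta_in X G \<longrightarrow> x \<in> G \<longrightarrow> G \<inter> A \<noteq> {})"
proof
  assume x: "x \<in> Gdelta_modification X closure_of A"
  have "G \<inter> A \<noteq> {}" if "gdelta_in X G" "x \<in> G" for G
  proof -
    have "openin (Gdelta_modification X) G"
      unfolding openin_Gdelta_modification using that(1)
      by (intro union_of_inc) (simp_all add: arbitrary_def)
    then show ?thesis using x that(2) unfolding in_closure_of by blast
  qed
  then show "x \<in> topspace X \<and> (\<forall>G. gdelta_in X G \<longrightarrow> x \<in> G \<longrightarrow> G \<inter> A \<noteq> {})"
    using x by (simp add: in_closure_of)
next
  assume x: "x \<in> topspace X \<and> (\<forall>G. gdelta_in X G \<longrightarrow> x \<in> G \<longrightarrow> G \<inter> A \<noteq> {})"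
  have "\<exists>y. y \<in> A \<and> y \<in> W" if W: "x \<in> W" "openin (Gdelta_modification X) W" for W
  proof -
    obtain \<U> where "\<U> \<subseteq> Collect (gdelta_in X)" "\<Union>\<U> = W"
      using W(2) by (auto simp: openin_Gdelta_modification union_of_def)
    then obtain G where "gdelta_in X G" "x \<in> G" "G \<subseteq> W" using W(1) by blast
    then show ?thesis using x by blast
  qed
  then show "x \<in> Gdelta_modification X closure_of A" using x by (simp add: in_closure_of)
qed

text \<open>Given a G_delta set around \<open>p\<close> missing \<open>A\<close>, colour each point
  of \<open>A\<close> by the index of an open set omitting it. This would be finite-to-one on every
  member of \<open>T\<close>.\<close>

lemma centre_in_Gdelta_closure:
  assumes TY: "\<And>t. t \<in> T \<Longrightarrow> t \<subseteq> A" and AY: "A \<subseteq> Y" and p: "p \<in> Y"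
    and col: "\<And>r :: 'a \<Rightarrow> nat. \<exists>t\<in>T. \<exists>n. infinite {x\<in>t. r x = n}"
  shows "p \<in> Gdelta_modification (spoke_topology Y p T) closure_of A"
  unfolding in_closure_of_Gdelta_modification
proof (intro conjI allI impI)
  have "t \<subseteq> Y" if "t \<in> T" for t using TY[OF that] AY by (rule order_trans)
  then have "topspace (spoke_topology Y p T) = Y" by (rule topspace_spoke_topology)
  then show "p \<in> topspace (spoke_topology Y p T)" using p by simp
  fix G assume G: "gdelta_in (spoke_topology Y p T) G" and pG: "p \<in> G"
  obtain \<U> where \<U>: "countable \<U>" "\<U> \<subseteq> Collect (openin (spoke_topology Y p T))" "\<Inter>\<U> = G"
    using G by (auto simp: gdelta_in_alt intersection_of_def)
  show "G \<inter> A \<noteq> {}"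
  proof
    assume "G \<inter> A = {}"
    then have "\<forall>x\<in>A. \<exists>U\<in>\<U>. x \<notin> U" using \<U>(3) by blast
    then obtain u where u: "\<And>x. x \<in> A \<Longrightarrow> u x \<in> \<U> \<and> x \<notin> u x" by metis
    obtain t n where t: "t \<in> T" "infinite {x\<in>t. to_nat_on \<U> (u x) = n}"
      using col[of "\<lambda>x. to_nat_on \<U> (u x)"] by blast
    then obtain x0 where x0: "x0 \<in> t" "to_nat_on \<U> (u x0) = n"
      using infinite_imp_nonempty by blast
    have "x \<notin> u x0" if "x \<in> t" "to_nat_on \<U> (u x) = n" for x
    proof -
      have "u x = u x0"
        using that x0 u TY[OF t(1)] inj_on_to_nat_on[OF \<U>(1)] by (metis inj_onD subsetD)
      then show ?thesis using u[of x] TY[OF t(1)] that(1) by auto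
    qed
    then have "{x\<in>t. to_nat_on \<U> (u x) = n} \<subseteq> t - u x0" by blast
    moreover have "finite (t - u x0)"
    proof -
      have "u x0 \<in> \<U>" using u x0(1) TY[OF t(1)] by blast
      then have "openin (spoke_topology Y p T) (u x0)" "p \<in> u x0" using \<U>(2,3) pG by blast+
      then show ?thesis using t(1) by (simp add: openin_spoke_topology)
    qed
    ultimately show False using t(2) finite_subset by blast
  qed
qed

text \<open>Removing one fibre of \<open>f\<close> on \<open>B\<close> leaves an open neighbourhood
  of \<open>p\<close>; the intersection of these misses \<open>B\<close>.\<close>

lemma centre_notin_Gdelta_closure:
  fixes f :: "'a \<Rightarrow> nat"
  assumes TY: "\<And>t. t \<in> T \<Longrightarrow> t \<subseteq> Y" and p: "p \<in> Y" "p \<notin> B"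
    and f: "\<And>t n. t \<in> T \<Longrightarrow> finite {x\<in>t. x \<in> B \<and> f x = n}"
  shows "p \<notin> Gdelta_modification (spoke_topology Y p T) closure_of B"
proof -
  let ?X = "spoke_topology Y p T"
  define U where "U n = Y - {x\<in>B. f x = n}" for n
  have "openin ?X (U n)" for n
  proof -
    have "finite (t - U n)" if "t \<in> T" for t
      by (rule rev_finite_subset[OF f[OF that, of n]]) (use TY[OF that] in \<open>auto simp: U_def\<close>)
    then show ?thesis by (simp add: openin_spoke_topology) (simp add: U_def)
  qed
  then have "gdelta_in ?X (\<Inter>(range U))"
    by (intro gdelta_in_Inter) (auto intro: open_imp_gdelta_in)
  moreover have "p \<in> \<Inter>(range U)" using p by (simp add: U_def)
  moreover have "\<Inter>(range U) \<inter> B = {}" by (auto simp: U_def)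
  ultimately show ?thesis unfolding in_closure_of_Gdelta_modification by blast
qed

section \<open>Tightness of the resulting space\<close>

theorem theorem4:
  assumes "MA_omega1 TYPE(nat set set)"
    and "ctwo ^c omega1 =o omega2"
  shows "\<exists>X :: nat set set option topology.
           topspace X = omega2_plus_1 \<and> Frechet_space X \<and>
           tightness (Gdelta_modification X) =o omega2"
proof -
  obtain S :: "om2 set set" where S: "\<forall>s\<in>S. ladder s"
    "\<forall>a. |{s\<in>S. s \<subseteq> {..<a}}| \<le>o |UNIV :: om1 set|"
    "\<forall>r :: om2 \<Rightarrow> nat. \<exists>s\<in>S. \<exists>n. infinite {x\<in>s. r x = n}"
    using ladder_family_exists[OF assms(2)] by (elim exE conjE) (rule that)
  define \<iota> where "\<iota> x = Some (Rep_om2 x)" for x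
  have inj: "inj \<iota>" using om2_iso(1) by (auto simp: \<iota>_def inj_def)
  have Y: "omega2_plus_1 = insert None (range \<iota>)"
    using om2_iso(2) unfolding omega2_plus_1_def \<iota>_def by (simp flip: image_image)
  define T where "T = (`) \<iota> ` S"
  define X where "X = spoke_topology omega2_plus_1 None T"
  have TA: "t \<subseteq> range \<iota>" if "t \<in> T" for t using that by (auto simp: T_def)
  then have TY: "t \<subseteq> omega2_plus_1" if "t \<in> T" for t using that unfolding Y by blast
  have top: "topspace X = omega2_plus_1" unfolding X_def using TY by (rule topspace_spoke_topology)
  have Frechet: "Frechet_space X" unfolding X_def using TY by (rule Frechet_spoke_topology)

  have in_closure: "None \<in> Gdelta_modification X closure_of range \<iota>"
    unfolding X_def
  proof (rule centre_in_Gdelta_closure[OF TA])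
    show "\<exists>t\<in>T. \<exists>n. infinite {x\<in>t. r x = n}" for r :: "_ \<Rightarrow> nat"
    proof -
      obtain s n where s: "s \<in> S" "infinite {x\<in>s. r (\<iota> x) = n}" using S(3)[rule_format, of "\<lambda>x. r (\<iota> x)"] by blast
      have "\<iota> ` {x\<in>s. r (\<iota> x) = n} = {y\<in>\<iota> ` s. r y = n}" by auto
      then have "infinite {y\<in>\<iota> ` s. r y = n}"
        using s(2) finite_image_iff[OF inj_on_subset[OF inj subset_UNIV], of "{x\<in>s. r (\<iota> x) = n}"]
        by simp
      moreover have "\<iota> ` s \<in> T" using s(1) by (simp add: T_def)
      ultimately show ?thesis by blast
    qed
  qed (auto simp: Y)

  \<comment> \<open>By regularity such a \<open>B\<close> is bounded in omega_2, so a function that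
    works on one initial segment suffices.\<close>
  have notin_closure: "None \<notin> Gdelta_modification X closure_of B"
    if B: "B \<subseteq> range \<iota>" "|B| \<le>o omega1" for B
  proof -
    have "|inv \<iota> ` B| \<le>o |UNIV :: om1 set|"
      by (rule ordLeq_transitive[OF card_of_image
            ordLeq_ordIso_trans[OF B(2) ordIso_symmetric[OF card_of_om1]]])
    then obtain a where a: "\<forall>x\<in>inv \<iota> ` B. x < a" using bounded_om2 by blast
    obtain f :: "om2 \<Rightarrow> nat" where f: "\<And>s n. s \<in> S \<Longrightarrow> finite {x\<in>s. x \<le> a \<and> f x = n}"
      using finite_to_one_on_initial_segments[OF assms(1) S(1,2)[rule_format], of a] by blast
    show ?thesis unfolding X_def
    proof (rule centre_notin_Gdelta_closure[OF TY, where f = "\<lambda>y. f (inv \<iota> y)"])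
      fix t n assume "t \<in> T"
      then obtain s where s: "s \<in> S" "t = \<iota> ` s" by (auto simp: T_def)
      have "{y\<in>t. y \<in> B \<and> f (inv \<iota> y) = n} \<subseteq> \<iota> ` {x\<in>s. x \<le> a \<and> f x = n}"
      proof
        fix y assume y: "y \<in> {y\<in>t. y \<in> B \<and> f (inv \<iota> y) = n}"
        then obtain x where x: "x \<in> s" "y = \<iota> x" using s(2) by blast
        then have "inv \<iota> y = x" using inj by simp
        then have "x < a" "f x = n" using a y by auto
        then show "y \<in> \<iota> ` {x\<in>s. x \<le> a \<and> f x = n}" using x by simp
      qed
      then show "finite {y\<in>t. y \<in> B \<and> f (inv \<iota> y) = n}"
        using f[OF s(1)] by (meson finite_imageI finite_subset)
    qed (use B(1) in \<open>auto simp: Y \<iota>_def\<close>)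
  qed

  have "|range \<iota>| \<le>o omega2"
    using card_of_image[of \<iota> UNIV] card_of_om2 by (rule ordLeq_ordIso_trans)
  moreover have "|{None :: nat set set option}| \<le>o omega2"
  proof -
    have "|{None :: nat set set option}| \<le>o |UNIV :: om2 set|" by (rule card_of_singl_ordLeq) simp
    then show ?thesis using card_of_om2 by (rule ordLeq_ordIso_trans)
  qed
  moreover have "infinite (Field omega2)"
    using cardSuc_finite[OF Card_order_omega1] infinite_Field_omega1 by simp
  ultimately have "|{None} \<union> range \<iota>| \<le>o omega2"
    by (intro card_of_Un_ordLeq_infinite_Field Card_order_omega2)
  then have card_Y: "|omega2_plus_1| \<le>o omega2" by (simp add: Y)
  have "point_tightness (Gdelta_modification X) x \<le>o omega2" for x
  proof (rule point_tightness(3)[OF Card_order_omega2])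
    fix A assume A: "A \<subseteq> topspace (Gdelta_modification X)" "x \<in> Gdelta_modification X closure_of A"
    have "|A| \<le>o |omega2_plus_1|" using A(1) by (intro card_of_mono1) (simp add: top)
    then have "|A| \<le>o omega2" using card_Y by (rule ordLeq_transitive)
    with A(2) show "\<exists>B\<subseteq>A. |B| \<le>o omega2 \<and> x \<in> Gdelta_modification X closure_of B" by blast
  qed
  then have le: "tightness (Gdelta_modification X) \<le>o omega2"
    by (intro tightness(3) Card_order_omega2)
  \<comment> \<open>Below the successor \<open>omega2\<close> means at most \<open>omega1\<close>;
    then the top would lie in the closure of a set of that size, against
    \<open>notin_closure\<close>.\<close>
  have ge: "omega2 \<le>o tightness (Gdelta_modification X)"
  proof (rule ccontr)
    let ?t = "tightness (Gdelta_modification X)"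
    assume "\<not> omega2 \<le>o ?t"
    then have "?t <o omega2"
      using tightness(1)[of "Gdelta_modification X"] Card_order_omega2
      by (simp add: not_ordLeq_iff_ordLess card_order_on_well_order_on)
    then have t: "?t \<le>o omega1"
      using cardSuc_ordLeq_ordLess[OF Card_order_omega1 tightness(1)] by blast
    have "None \<in> topspace (Gdelta_modification X)" by (simp add: top Y)
    then have pt: "point_tightness (Gdelta_modification X) None \<le>o omega1"
      by (rule ordLeq_transitive[OF tightness(2) t])
    have "range \<iota> \<subseteq> topspace (Gdelta_modification X)" by (auto simp: top Y)
    then obtain B where B: "B \<subseteq> range \<iota>" "|B| \<le>o point_tightness (Gdelta_modification X) None"
        "None \<in> Gdelta_modification X closure_of B"
      using point_tightness(2)[OF _ in_closure] by metis
    have "|B| \<le>o omega1" using B(2) pt by (rule ordLeq_transitive)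
    with notin_closure[OF B(1)] B(3) show False by simp
  qed
  show ?thesis using top Frechet le ge by (auto simp: ordIso_iff_ordLeq)
qed

end
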